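(* Let $\mathfrak g$ be a (finite-dimensional, real, even-dimensional) unimodular Lie algebra which contains an abelian ideal of codimension $2$, and let $J$ be any complex structure on $\mathfrak g$. If $(\mathfrak g,J)$ admits a compatible balanced metric and a compatible pluriclosed metric (possibly different from each other), then $(\mathfrak g,J)$ admits a compatible Kähler metric.
   Context: Let $\mathfrak g$ be a real Lie algebra of dimension $2n$. It is unimodular if $\mathrm{tr}(\mathrm{ad}_x)=0$ for all $x\in\mathfrak g$. A complex structure on $\mathfrak g$ is a linear map $J:\mathfrak g\to\mathfrak g$ with $J^2=-I$ and $[x,y]-[Jx,Jy]+J[Jx,y]+J[x,Jy]=0$ for all $x,y\in\mathfrak g$. A metric compatible with $J$ is an inner product $g$ on $\mathfrak g$ with $g(Jx,Jy)=g(x,y)$; its Kähler form is $\omega(x,y)=g(Jx,y)$. Let $d$ be the Chevalley–Eilenberg differential on $\Lambda^\bullet\mathfrak g^*\otimes\mathbb C$ (equivalently, the exterior differential on left-invariant forms on a Lie group with Lie algebra $\mathfrak g$); by integrability of $J$ it splits as $d=\partial+\overline\partial$ with respect to the bidegree defined by $J$. The metric $g$ is balanced if $d(\omega^{n-1})=0$, pluriclosed if $\partial\overline\partial\omega=0$, and Kähler if $d\omega=0$. The assertion that the Fino–Vezzoni Conjecture holds for $\mathfrak g$ means: for every complex structure $J$ on $\mathfrak g$, if $(\mathfrak g,J)$ admits a compatible balanced metric and a compatible pluriclosed metric, then it admits a compatible Kähler metric. *)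

theory Defs
  imports "HOL-Analysis.Analysis"
begin

section \<open>Lie algebras\<close>

text \<open>
  The underlying vector space is a type of class \<^class>\<open>euclidean_space\<close>. The inner product that
  comes with the class only serves to compute traces in coordinates; Hermitian metrics are separate
  bilinear forms.
\<close>

definition lie_bracket :: "('a::real_vector \<Rightarrow> 'a \<Rightarrow> 'a) \<Rightarrow> bool" where
  "lie_bracket br \<longleftrightarrow> bilinear br \<and> (\<forall>x. br x x = 0) \<and>
     (\<forall>x y z. br x (br y z) + br y (br z x) + br z (br x y) = 0)"

definition linear_trace :: "('a::euclidean_space \<Rightarrow> 'a) \<Rightarrow> real" where
  "linear_trace f = (\<Sum>b\<in>Basis. f b \<bullet> b)"

definition unimodular :: "('a::euclidean_space \<Rightarrow> 'a \<Rightarrow> 'a) \<Rightarrow> bool" where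
  "unimodular br \<longleftrightarrow> (\<forall>x. linear_trace (br x) = 0)"

definition lie_ideal :: "('a::real_vector \<Rightarrow> 'a \<Rightarrow> 'a) \<Rightarrow> 'a set \<Rightarrow> bool" where
  "lie_ideal br A \<longleftrightarrow> subspace A \<and> (\<forall>x. \<forall>a\<in>A. br x a \<in> A)"

definition abelian_on :: "('a::real_vector \<Rightarrow> 'a \<Rightarrow> 'a) \<Rightarrow> 'a set \<Rightarrow> bool" where
  "abelian_on br A \<longleftrightarrow> (\<forall>a\<in>A. \<forall>b\<in>A. br a b = 0)"

definition complex_structure :: "('a::real_vector \<Rightarrow> 'a \<Rightarrow> 'a) \<Rightarrow> ('a \<Rightarrow> 'a) \<Rightarrow> bool" where
  "complex_structure br J \<longleftrightarrow> linear J \<and> (\<forall>x. J (J x) = - x) \<and>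
     (\<forall>x y. br x y - br (J x) (J y) + J (br (J x) y) + J (br x (J y)) = 0)"


section \<open>Complex-valued forms\<close>

text \<open>
  An element of the graded algebra of complex-valued alternating forms is a function on lists of
  vectors: its component of degree \<open>k\<close> is the restriction to lists of length \<open>k\<close>. In particular a
  form of pure degree \<open>k\<close> is \<open>0\<close> on lists of any other length.
\<close>

type_synonym 'a form = "'a list \<Rightarrow> complex"

definition form_one :: "'a form" where
  "form_one xs = (if xs = [] then 1 else 0)"

text \<open>
  The wedge product as a sum over shuffles: \<open>S\<close> is the set of positions whose arguments go to the
  first factor, and the exponent counts the inversions of the corresponding shuffle.
\<close>

definition wedge :: "'a form \<Rightarrow> 'a form \<Rightarrow> 'a form" where
  "wedge \<alpha> \<beta> xs =
     (\<Sum>S\<in>Pow {..<length xs}.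
        (-1) ^ card {(i, j). i \<in> S \<and> j \<in> {..<length xs} - S \<and> j < i} *
        \<alpha> (nths xs S) * \<beta> (nths xs ({..<length xs} - S)))"

definition wedge_power :: "'a form \<Rightarrow> nat \<Rightarrow> 'a form" where
  "wedge_power \<alpha> m = (wedge \<alpha> ^^ m) form_one"

text \<open>
  The Chevalley--Eilenberg differential
  \<open>(d\<alpha>)(x\<^sub>0,\<dots>,x\<^sub>k) = \<Sum>\<^sub>i\<^sub><\<^sub>j (-1)\<^sup>i\<^sup>+\<^sup>j \<alpha>([x\<^sub>i,x\<^sub>j], x\<^sub>0, \<dots>, x\<^sub>k)\<close>,
  with \<open>x\<^sub>i\<close> and \<open>x\<^sub>j\<close> omitted after the bracket.
\<close>

definition ce_diff :: "('a \<Rightarrow> 'a \<Rightarrow> 'a) \<Rightarrow> 'a form \<Rightarrow> 'a form" where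
  "ce_diff br \<alpha> xs =
     (\<Sum>j<length xs. \<Sum>i<j.
        (-1) ^ (i + j) * \<alpha> (br (xs ! i) (xs ! j) # nths xs ({..<length xs} - {i, j})))"


section \<open>Bidegree and the operators \<open>\<partial>\<close> and its conjugate\<close>

text \<open>
  The complex multilinear extension of a form to the complexification, where the pair \<open>(u, v)\<close>
  stands for \<open>u + \<i> v\<close>.
\<close>

definition complexify :: "'a form \<Rightarrow> ('a \<times> 'a) list \<Rightarrow> complex" where
  "complexify \<alpha> zs =
     (\<Sum>T\<in>Pow {..<length zs}. \<i> ^ card T *
        \<alpha> (map (\<lambda>k. if k \<in> T then snd (zs ! k) else fst (zs ! k)) [0..<length zs]))"

text \<open>
  The projections \<open>(x - \<i> J x) / 2\<close> and \<open>(x + \<i> J x) / 2\<close> of a real vector to the eigenspaces of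
  \<open>J\<close> for the eigenvalues \<open>\<i>\<close> and \<open>-\<i>\<close>.
\<close>

definition proj10 :: "('a::real_vector \<Rightarrow> 'a) \<Rightarrow> 'a \<Rightarrow> 'a \<times> 'a" where
  "proj10 J x = ((1/2) *\<^sub>R x, - (1/2) *\<^sub>R J x)"

definition proj01 :: "('a::real_vector \<Rightarrow> 'a) \<Rightarrow> 'a \<Rightarrow> 'a \<times> 'a" where
  "proj01 J x = ((1/2) *\<^sub>R x, (1/2) *\<^sub>R J x)"

text \<open>
  The component of bidegree \<open>(p, q)\<close>: substitute \<open>x = x\<^sup>1\<^sup>,\<^sup>0 + x\<^sup>0\<^sup>,\<^sup>1\<close> for every argument, expand,
  and keep the terms with exactly \<open>p\<close> arguments of type \<open>(1,0)\<close> and \<open>q\<close> of type \<open>(0,1)\<close>.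
\<close>

definition bidegree_part :: "('a::real_vector \<Rightarrow> 'a) \<Rightarrow> nat \<Rightarrow> nat \<Rightarrow> 'a form \<Rightarrow> 'a form" where
  "bidegree_part J p q \<alpha> xs =
     (if length xs = p + q
      then \<Sum>S | S \<subseteq> {..<p + q} \<and> card S = p.
             complexify \<alpha>
               (map (\<lambda>k. if k \<in> S then proj10 J (xs ! k) else proj01 J (xs ! k)) [0..<p + q])
      else 0)"

text \<open>
  On forms of bidegree \<open>(p, q)\<close>, \<open>\<partial>\<close> and its conjugate are the components of \<open>d\<close> of bidegree
  \<open>(p + 1, q)\<close> and \<open>(p, q + 1)\<close>; the sums run over all \<open>p + q = k\<close>, where \<open>k + 1\<close> is the number of
  arguments.
\<close>

definition del :: "('a::real_vector \<Rightarrow> 'a \<Rightarrow> 'a) \<Rightarrow> ('a \<Rightarrow> 'a) \<Rightarrow> 'a form \<Rightarrow> 'a form" where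
  "del br J \<alpha> xs =
     (\<Sum>(p, q) | p + q + 1 = length xs.
        bidegree_part J (p + 1) q (ce_diff br (bidegree_part J p q \<alpha>)) xs)"

definition delbar :: "('a::real_vector \<Rightarrow> 'a \<Rightarrow> 'a) \<Rightarrow> ('a \<Rightarrow> 'a) \<Rightarrow> 'a form \<Rightarrow> 'a form" where
  "delbar br J \<alpha> xs =
     (\<Sum>(p, q) | p + q + 1 = length xs.
        bidegree_part J p (q + 1) (ce_diff br (bidegree_part J p q \<alpha>)) xs)"


section \<open>Hermitian metrics\<close>

definition inner_product :: "('a::real_vector \<Rightarrow> 'a \<Rightarrow> real) \<Rightarrow> bool" where
  "inner_product g \<longleftrightarrow> bilinear g \<and> (\<forall>x y. g x y = g y x) \<and> (\<forall>x. x \<noteq> 0 \<longrightarrow> g x x > 0)"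

definition compatible_metric :: "('a::real_vector \<Rightarrow> 'a) \<Rightarrow> ('a \<Rightarrow> 'a \<Rightarrow> real) \<Rightarrow> bool" where
  "compatible_metric J g \<longleftrightarrow> inner_product g \<and> (\<forall>x y. g (J x) (J y) = g x y)"

definition kaehler_form :: "('a \<Rightarrow> 'a) \<Rightarrow> ('a \<Rightarrow> 'a \<Rightarrow> real) \<Rightarrow> 'a form" where
  "kaehler_form J g xs = (if length xs = 2 then complex_of_real (g (J (xs ! 0)) (xs ! 1)) else 0)"

definition balanced ::
  "('a::euclidean_space \<Rightarrow> 'a \<Rightarrow> 'a) \<Rightarrow> ('a \<Rightarrow> 'a) \<Rightarrow> ('a \<Rightarrow> 'a \<Rightarrow> real) \<Rightarrow> bool" where
  "balanced br J g \<longleftrightarrow>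
     (\<forall>xs. ce_diff br (wedge_power (kaehler_form J g) (DIM('a) div 2 - 1)) xs = 0)"

definition pluriclosed ::
  "('a::real_vector \<Rightarrow> 'a \<Rightarrow> 'a) \<Rightarrow> ('a \<Rightarrow> 'a) \<Rightarrow> ('a \<Rightarrow> 'a \<Rightarrow> real) \<Rightarrow> bool" where
  "pluriclosed br J g \<longleftrightarrow> (\<forall>xs. del br J (delbar br J (kaehler_form J g)) xs = 0)"

definition kaehler ::
  "('a::real_vector \<Rightarrow> 'a \<Rightarrow> 'a) \<Rightarrow> ('a \<Rightarrow> 'a) \<Rightarrow> ('a \<Rightarrow> 'a \<Rightarrow> real) \<Rightarrow> bool" where
  "kaehler br J g \<longleftrightarrow> (\<forall>xs. ce_diff br (kaehler_form J g) xs = 0)"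

end

theory Submission imports Defs begin

text \<open>
  Write \<open>g\<close> for the pluriclosed metric, \<open>\<omega>\<close> for its Kaehler form, \<open>h\<close> for the balanced metric and
  \<open>A\<close> for the abelian ideal. Two consequences of the hypotheses suffice. Balancedness, in the
  presence of unimodularity, says that the sum of \<open>[e, J e]\<close> over a unitary frame of \<open>h\<close> vanishes.
  Pluriclosedness is used only on arguments of the form \<open>(u, J u, v, J v)\<close>, where it says that
  the differential of \<open>(x, y, z) \<mapsto> d\<omega> (J x) (J y) (J z)\<close> vanishes. Taking \<open>v\<close> in a complex abelian
  ideal \<open>U\<close> and summing over a unitary frame of \<open>U\<close> turns this into a vanishing sum of squares, which
  forces the operators \<open>ad x\<close> to preserve \<open>\<omega>\<close> on \<open>U\<close>.

  If \<open>J A = A\<close>, take \<open>U = A\<close>: the \<open>h\<close>-orthogonal complement of \<open>A\<close> is spanned by some \<open>x\<close> and \<open>J x\<close>,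
  the balanced condition gives \<open>[x, J x] = 0\<close>, and \<open>g\<close> made block diagonal with respect to the
  decomposition into \<open>A\<close> and the span of \<open>x, J x\<close> is Kaehler.

  If \<open>J A \<noteq> A\<close>, take \<open>U = A \<inter> J A\<close>, of codimension four, with \<open>p, q\<close> spanning a complement of \<open>U\<close>
  in \<open>A\<close>. Unimodularity and the Jacobi identity show that \<open>ad (J p)\<close> and \<open>ad (J q)\<close> map \<open>A\<close> to \<open>U\<close>.
  After subtracting suitable elements of \<open>U\<close> from \<open>p\<close> and \<open>q\<close>, the images of \<open>p\<close> and \<open>q\<close> lie in the
  common kernel of both operators, and the pluriclosed condition on \<open>(p, J p, q, J q)\<close> becomes a
  vanishing sum of squares; hence \<open>p, q, J p, J q\<close> commute and again a block diagonal metric is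
  Kaehler.
\<close>

section \<open>Wedge powers and the differential on lists of vectors\<close>

lemma sum_Pow_lessThan_Suc:
  fixes f :: "nat set \<Rightarrow> 'b::comm_monoid_add"
  shows "(\<Sum>S\<in>Pow {..<Suc n}. f S)
    = (\<Sum>T\<in>Pow {..<n}. f (Suc ` T)) + (\<Sum>T\<in>Pow {..<n}. f (insert 0 (Suc ` T)))"
proof -
  have P: "Pow {..<Suc n} = (`) Suc ` Pow {..<n} \<union> (insert 0 \<circ> (`) Suc) ` Pow {..<n}"
    unfolding lessThan_Suc_eq_insert_0 Pow_insert image_comp[symmetric] image_Pow_surj[OF refl] by simp
  have i1: "inj_on ((`) Suc) (Pow {..<n})"
    by (auto intro!: inj_onI simp: inj_image_eq_iff)
  have i2: "inj_on (insert 0 \<circ> (`) Suc) (Pow {..<n})"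
  proof (rule inj_onI)
    fix x y assume "(insert 0 \<circ> (`) Suc) x = (insert 0 \<circ> (`) Suc) y"
    hence "Suc ` x = Suc ` y" by (simp add: set_eq_iff image_iff) blast
    thus "x = y" by (simp add: inj_image_eq_iff)
  qed
  show ?thesis unfolding P
    by (subst sum.union_disjoint)
       (auto simp: sum.reindex[OF i1] sum.reindex[OF i2, unfolded comp_def] comp_def)
qed

lemma nths_Cons_image_Suc: "nths (x # xs) (Suc ` T) = nths xs T"
  "nths (x # xs) (insert 0 (Suc ` T)) = x # nths xs T"
  by (simp_all add: nths_Cons image_iff)

lemma Suc_image_diff: "{..<Suc n} - Suc ` T = insert 0 (Suc ` ({..<n} - T))"
  "{..<Suc n} - insert 0 (Suc ` T) = Suc ` ({..<n} - T)"
  by (auto simp: lessThan_Suc_eq_insert_0)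

definition inversions :: "nat \<Rightarrow> nat set \<Rightarrow> (nat \<times> nat) set" where
  "inversions n S = {(i, j). i \<in> S \<and> j \<in> {..<n} - S \<and> j < i}"

lemma finite_inversions: "T \<subseteq> {..<n} \<Longrightarrow> finite (inversions n T)"
  by (rule finite_subset[of _ "{..<n} \<times> {..<n}"]) (auto simp: inversions_def)

text \<open>Position 0 lies below all others: sent to the second factor it forms an inversion with
  every element of \<open>T\<close>, sent to the first factor it forms none.\<close>

lemma card_inversions_Suc:
  assumes "T \<subseteq> {..<n}"
  shows "card (inversions (Suc n) (Suc ` T)) = card T + card (inversions n T)"
    and "card (inversions (Suc n) (insert 0 (Suc ` T))) = card (inversions n T)"
proof -
  have fT: "finite T" using assms finite_subset by blast
  have e1: "inversions (Suc n) (Suc ` T) = T' \<union> map_prod Suc Suc ` inversions n T"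
    if "T' = (\<lambda>i. (Suc i, 0)) ` T" for T'
    using assms unfolding that inversions_def map_prod_def Suc_image_diff by force
  have e2: "inversions (Suc n) (insert 0 (Suc ` T)) = map_prod Suc Suc ` inversions n T"
    using assms unfolding inversions_def map_prod_def Suc_image_diff by force
  have c: "card (map_prod Suc Suc ` inversions n T) = card (inversions n T)"
    by (intro card_image) (auto simp: inj_on_def)
  have c2: "card ((\<lambda>i. (Suc i, 0::nat)) ` T) = card T"
    by (intro card_image) (auto simp: inj_on_def)
  show "card (inversions (Suc n) (Suc ` T)) = card T + card (inversions n T)"
    unfolding e1[OF refl] using fT finite_inversions[OF assms]
    by (subst card_Un_disjoint) (auto simp: c c2)
  show "card (inversions (Suc n) (insert 0 (Suc ` T))) = card (inversions n T)"
    unfolding e2 c ..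
qed

lemma length_nths_subset: "T \<subseteq> {..<length xs} \<Longrightarrow> length (nths xs T) = card T"
  unfolding length_nths by (rule arg_cong[where f = card]) auto

lemma wedge_Nil: "wedge \<alpha> \<beta> [] = \<alpha> [] * \<beta> []"
  by (simp add: wedge_def)

text \<open>Contraction with \<open>x\<close> is a graded derivation. The shuffles are split by the
  destination of position 0; those sending it to the second factor gain the sign (-1)^card T, and
  \<alpha> is nonzero only when card T = \<open>k\<close>.\<close>

lemma wedge_Cons:
  assumes "\<And>ys. length ys \<noteq> k \<Longrightarrow> \<alpha> ys = 0"
  shows "wedge \<alpha> \<beta> (x # xs)
    = wedge (\<lambda>ys. \<alpha> (x # ys)) \<beta> xs + (-1) ^ k * wedge \<alpha> (\<lambda>ys. \<beta> (x # ys)) xs"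
proof -
  define n where "n = length xs"
  have W: "wedge \<alpha> \<beta> ys = (\<Sum>S\<in>Pow {..<length ys}. (-1) ^ card (inversions (length ys) S)
      * \<alpha> (nths ys S) * \<beta> (nths ys ({..<length ys} - S)))" for \<alpha> \<beta> :: "'a form" and ys
    by (simp add: wedge_def inversions_def)
  have "(-1) ^ card (inversions (Suc n) (Suc ` T)) * \<alpha> (nths (x # xs) (Suc ` T))
      * \<beta> (nths (x # xs) ({..<Suc n} - Suc ` T))
    = (-1) ^ k * ((-1) ^ card (inversions n T) * \<alpha> (nths xs T) * \<beta> (x # nths xs ({..<n} - T)))"
    if "T \<in> Pow {..<n}" for T
    using that assms[of "nths xs T"] length_nths_subset[of T xs]
    by (cases "card T = k")
       (simp_all add: card_inversions_Suc nths_Cons_image_Suc Suc_image_diff power_add n_def)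
  moreover have "(-1) ^ card (inversions (Suc n) (insert 0 (Suc ` T)))
      * \<alpha> (nths (x # xs) (insert 0 (Suc ` T))) * \<beta> (nths (x # xs) ({..<Suc n} - insert 0 (Suc ` T)))
    = (-1) ^ card (inversions n T) * \<alpha> (x # nths xs T) * \<beta> (nths xs ({..<n} - T))"
    if "T \<in> Pow {..<n}" for T
    using that by (simp add: card_inversions_Suc nths_Cons_image_Suc Suc_image_diff)
  ultimately show ?thesis
    unfolding W[of _ _ "x # xs"] W[of _ _ xs] list.size(4) add_Suc_right add_0_right n_def[symmetric]
      sum_Pow_lessThan_Suc sum_distrib_left
    by (subst add.commute, intro arg_cong2[of _ _ _ _ "(+)"] sum.cong refl) assumption+
qed

section \<open>The differential as a recursion over the list of arguments\<close>

fun delsum :: "('a \<Rightarrow> 'a list \<Rightarrow> complex) \<Rightarrow> 'a list \<Rightarrow> complex" where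
  "delsum f [] = 0"
| "delsum f (y # ys) = f y ys - delsum (\<lambda>z zs. f z (y # zs)) ys"

text \<open>For two entries of the tail both indices shift by one, so the sign is unchanged; for a
  pair containing the head only the other index shifts, which gives the minus sign.\<close>

fun pairsum :: "('a \<Rightarrow> 'a \<Rightarrow> 'a list \<Rightarrow> complex) \<Rightarrow> 'a list \<Rightarrow> complex" where
  "pairsum f [] = 0"
| "pairsum f (y # ys) = pairsum (\<lambda>a b zs. f a b (y # zs)) ys - delsum (f y) ys"

lemma delsum_conv_sum:
  "delsum f xs = (\<Sum>j<length xs. (-1) ^ j * f (xs ! j) (nths xs ({..<length xs} - {j})))"
proof (induction xs arbitrary: f)
  case (Cons x xs)
  have e: "{..<Suc n} - {Suc j} = insert 0 (Suc ` ({..<n} - {j}))" for n j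
    using Suc_image_diff(1)[of n "{j}"] by simp
  have e0: "{..<Suc n} - {0} = Suc ` ({..<n})" for n
    by (auto simp: lessThan_Suc_eq_insert_0)
  show ?case
    by (simp only: delsum.simps Cons.IH list.size add_Suc_right add_0_right sum.lessThan_Suc_shift e e0
        nths_Cons_image_Suc) (simp add: sum_negf nths_all)
qed simp

lemma ce_diff_conv_pairsum: "ce_diff br \<alpha> xs = pairsum (\<lambda>a b zs. \<alpha> (br a b # zs)) xs"
proof -
  have "pairsum f xs = (\<Sum>j<length xs. \<Sum>i<j.
        (-1) ^ (i + j) * f (xs ! i) (xs ! j) (nths xs ({..<length xs} - {i, j})))" for f
  proof (induction xs arbitrary: f)
    case (Cons x xs)
    have e: "{..<Suc n} - {0, Suc j} = Suc ` ({..<n} - {j})" for n j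
      using Suc_image_diff(2)[of n "{j}"] by simp
    have e': "{..<Suc n} - {Suc i, Suc j} = insert 0 (Suc ` ({..<n} - {i, j}))" for n i j
      using Suc_image_diff(1)[of n "{i, j}"] by simp
    show ?case
      by (simp only: pairsum.simps Cons.IH list.size add_Suc_right add_0_right
          sum.lessThan_Suc_shift e e' nths_Cons_image_Suc delsum_conv_sum)
         (simp add: sum_negf sum_subtractf)
  qed simp
  thus ?thesis by (simp add: ce_diff_def)
qed

text \<open>The premise records only which vectors can occur. This suffices later, where summands
  vanish or simplify by orthogonality to all members of the list.\<close>

lemma delsum_cong:
  "(\<And>z zs. z \<in> set ys \<Longrightarrow> set zs \<subseteq> set ys \<Longrightarrow> f z zs = g z zs) \<Longrightarrow> delsum f ys = delsum g ys"
proof (induction ys arbitrary: f g)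
  case (Cons y ys)
  have "delsum (\<lambda>z zs. f z (y # zs)) ys = delsum (\<lambda>z zs. g z (y # zs)) ys"
    by (rule Cons.IH) (rule Cons.prems, auto)
  moreover have "f y ys = g y ys" by (rule Cons.prems) auto
  ultimately show ?case by simp
qed simp

lemma pairsum_cong:
  "(\<And>a b zs. a \<in> set ys \<Longrightarrow> b \<in> set ys \<Longrightarrow> set zs \<subseteq> set ys \<Longrightarrow> f a b zs = g a b zs)
    \<Longrightarrow> pairsum f ys = pairsum g ys"
proof (induction ys arbitrary: f g)
  case (Cons y ys)
  have "pairsum (\<lambda>a b zs. f a b (y # zs)) ys = pairsum (\<lambda>a b zs. g a b (y # zs)) ys"
    by (rule Cons.IH) (rule Cons.prems, auto)
  moreover have "delsum (f y) ys = delsum (g y) ys"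
    by (rule delsum_cong) (rule Cons.prems, auto)
  ultimately show ?case by simp
qed simp

lemma delsum_cmult: "delsum (\<lambda>z zs. c * f z zs) ys = c * delsum f ys"
  by (induction ys arbitrary: f) (simp_all add: right_diff_distrib)

lemma pairsum_cmult: "pairsum (\<lambda>a b zs. c * f a b zs) ys = c * pairsum f ys"
  by (induction ys arbitrary: f) (simp_all add: right_diff_distrib delsum_cmult)

lemma delsum_zero: "delsum (\<lambda>z zs. 0) ys = 0"
  by (induction ys) simp_all

section \<open>Products with one-forms and powers of a two-form\<close>

definition one_form :: "('a \<Rightarrow> real) \<Rightarrow> 'a form" where
  "one_form \<phi> ys = (if length ys = 1 then complex_of_real (\<phi> (ys ! 0)) else 0)"

lemma wedge_const: "wedge (\<lambda>ys. if ys = [] then c else 0) \<beta> xs = c * \<beta> xs"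
proof (induction xs arbitrary: \<beta>)
  case Nil thus ?case by (simp add: wedge_Nil)
next
  case (Cons x xs)
  have "wedge (\<lambda>ys. 0) \<beta> xs = 0" by (simp add: wedge_def)
  thus ?case by (subst wedge_Cons[where k = 0]) (auto simp: Cons.IH)
qed

lemma wedge_one_form:
  "wedge (one_form \<phi>) \<beta> xs = delsum (\<lambda>z zs. complex_of_real (\<phi> z) * \<beta> zs) xs"
proof (induction xs arbitrary: \<beta>)
  case Nil thus ?case by (simp add: wedge_Nil one_form_def)
next
  case (Cons x xs)
  have "(\<lambda>ys. one_form \<phi> (x # ys)) = (\<lambda>ys. if ys = [] then complex_of_real (\<phi> x) else 0)"
    by (auto simp: one_form_def fun_eq_iff)
  thus ?case
    by (subst wedge_Cons[where k = 1]) (auto simp: one_form_def[of _ "_"] wedge_const Cons.IH)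
qed

lemma wedge_one_form_Cons:
  "wedge (one_form \<phi>) \<beta> (x # xs)
    = complex_of_real (\<phi> x) * \<beta> xs - wedge (one_form \<phi>) (\<lambda>ys. \<beta> (x # ys)) xs"
  by (simp add: wedge_one_form)

lemma wedge_diff_right: "wedge \<alpha> (\<lambda>ys. \<beta> ys - \<gamma> ys) xs = wedge \<alpha> \<beta> xs - wedge \<alpha> \<gamma> xs"
  by (simp add: wedge_def right_diff_distrib sum_subtractf)

lemma wedge_add_right: "wedge \<alpha> (\<lambda>ys. \<beta> ys + \<gamma> ys) xs = wedge \<alpha> \<beta> xs + wedge \<alpha> \<gamma> xs"
  by (simp add: wedge_def distrib_left sum.distrib)

lemma wedge_cmult_right: "wedge \<alpha> (\<lambda>ys. c * \<beta> ys) xs = c * wedge \<alpha> \<beta> xs"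
  by (simp add: wedge_def sum_distrib_left mult_ac)

lemma wedge_one_form_anticommute:
  "wedge (one_form \<phi>) (wedge (one_form \<psi>) \<beta>) xs = - wedge (one_form \<psi>) (wedge (one_form \<phi>) \<beta>) xs"
proof (induction xs arbitrary: \<beta>)
  case Nil thus ?case by (simp add: wedge_Nil one_form_def)
next
  case (Cons x xs)
  show ?case
    by (simp add: wedge_one_form_Cons wedge_diff_right wedge_cmult_right Cons.IH)
qed

definition two_form :: "('a \<Rightarrow> 'a \<Rightarrow> real) \<Rightarrow> 'a form" where
  "two_form w ys = (if length ys = 2 then complex_of_real (w (ys ! 0) (ys ! 1)) else 0)"

lemma wedge_two_form_Cons:
  "wedge (two_form w) \<beta> (x # xs)
    = wedge (one_form (w x)) \<beta> xs + wedge (two_form w) (\<lambda>ys. \<beta> (x # ys)) xs"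
proof -
  have "(\<lambda>ys. two_form w (x # ys)) = one_form (w x)"
    by (auto simp: one_form_def two_form_def fun_eq_iff)
  thus ?thesis by (subst wedge_Cons[where k = 2]) (auto simp: two_form_def)
qed

text \<open>Contracting with the first argument reduces the claim to shorter lists; the extra term
  from contracting \<open>w\<close> is matched by anticommutativity of one-forms.\<close>

lemma wedge_two_form_one_form:
  "wedge (two_form w) (wedge (one_form \<phi>) \<beta>) xs = wedge (one_form \<phi>) (wedge (two_form w) \<beta>) xs"
proof (induction xs arbitrary: \<beta>)
  case Nil thus ?case by (simp add: wedge_Nil one_form_def)
next
  case (Cons x xs)
  show ?case
    by (simp add: wedge_two_form_Cons wedge_one_form_Cons wedge_diff_right wedge_add_right
        wedge_cmult_right Cons.IH wedge_one_form_anticommute[of "w x"])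
qed

lemma wedge_power_0: "wedge_power \<alpha> 0 = form_one"
  by (simp add: wedge_power_def)

lemma wedge_power_Suc: "wedge_power \<alpha> (Suc m) = wedge \<alpha> (wedge_power \<alpha> m)"
  by (simp add: wedge_power_def)

text \<open>By the derivation rule every factor contributes the same term, since the one-form
  \<open>w x\<close> can be moved past the two-form.\<close>

lemma wedge_power_two_form_Cons:
  "wedge_power (two_form w) (Suc m) (x # xs)
    = of_nat (Suc m) * wedge (one_form (w x)) (wedge_power (two_form w) m) xs"
proof (induction m arbitrary: xs)
  case 0
  have "wedge (two_form w) (\<lambda>ys. 0) xs = 0" by (simp add: wedge_def)
  thus ?case by (simp add: wedge_power_0 wedge_power_Suc wedge_two_form_Cons form_one_def[of "_ # _"])
next
  case (Suc m)
  have "wedge_power (two_form w) (Suc (Suc m)) (x # xs)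
    = wedge (one_form (w x)) (wedge_power (two_form w) (Suc m)) xs
      + wedge (two_form w) (\<lambda>ys. wedge_power (two_form w) (Suc m) (x # ys)) xs"
    by (simp only: wedge_power_Suc[of _ "Suc m"] wedge_two_form_Cons)
  also have "wedge (two_form w) (\<lambda>ys. wedge_power (two_form w) (Suc m) (x # ys)) xs
    = of_nat (Suc m) * wedge (one_form (w x)) (wedge_power (two_form w) (Suc m)) xs"
    by (simp only: Suc.IH wedge_cmult_right) (simp only: wedge_two_form_one_form wedge_power_Suc)
  finally show ?case by (simp add: algebra_simps)
qed

text \<open>A double contraction produces a term with the scalar \<open>w x y\<close>, skew by
  assumption, and a term with the product of the one-forms \<open>w x\<close> and
  \<open>w y\<close>, which anticommute.\<close>

lemma wedge_power_two_form_swap: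
  assumes "\<And>x y. w x y = - w y x"
  shows "wedge_power (two_form w) m (x # y # zs) = - wedge_power (two_form w) m (y # x # zs)"
proof (cases m)
  case 0 thus ?thesis by (simp add: wedge_power_def form_one_def)
next
  case (Suc k)
  show ?thesis
  proof (cases k)
    case 0
    have "w x y = - w y x" by (rule assms)
    moreover have "delsum (\<lambda>z zs. 0) zs = 0" by (rule delsum_zero)
    ultimately show ?thesis
      by (simp add: Suc 0 wedge_power_two_form_Cons wedge_one_form wedge_power_0 form_one_def)
  next
    case (Suc j)
    have "complex_of_real (w x y) = - complex_of_real (w y x)" by (subst assms) simp
    thus ?thesis unfolding \<open>m = Suc k\<close> Suc
      by (simp only: wedge_power_two_form_Cons wedge_one_form_Cons wedge_cmult_right
          wedge_one_form_anticommute[of "w x"]) (simp add: algebra_simps)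
  qed
qed

section \<open>Powers of the Kaehler form on unitary frames\<close>

primrec pairs :: "('a \<Rightarrow> 'a) \<Rightarrow> 'a list \<Rightarrow> 'a list" where
  "pairs J [] = []"
| "pairs J (e # es) = e # J e # pairs J es"

text \<open>Amounts to orthonormality of \<open>pairs J es\<close> for a compatible
  \<open>g\<close>: the remaining relations follow from symmetry and invariance under
  \<open>J\<close>.\<close>

primrec unitary :: "('a \<Rightarrow> 'a) \<Rightarrow> ('a::real_vector \<Rightarrow> 'a \<Rightarrow> real) \<Rightarrow> 'a list \<Rightarrow> bool" where
  "unitary J g [] = True"
| "unitary J g (e # es) \<longleftrightarrow> g e e = 1 \<and> (\<forall>f\<in>set es. g e f = 0 \<and> g e (J f) = 0) \<and> unitary J g es"

lemma set_pairs: "set (pairs J es) = set es \<union> J ` set es"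
  by (induction es) auto

locale hermitian =
  fixes J :: "'a::euclidean_space \<Rightarrow> 'a" and g :: "'a \<Rightarrow> 'a \<Rightarrow> real"
  assumes linear_J: "linear J" and J_J [simp]: "J (J x) = - x"
    and metric: "compatible_metric J g"
begin

lemma bilinear_g: "bilinear g" and g_sym: "g x y = g y x"
  and g_pos: "x \<noteq> 0 \<Longrightarrow> g x x > 0" and g_J_J [simp]: "g (J x) (J y) = g x y"
  using metric by (auto simp: compatible_metric_def inner_product_def)

lemmas J_simps [simp] = linear_add[OF linear_J] linear_diff[OF linear_J] linear_neg[OF linear_J]
  linear_scale[OF linear_J] linear_0[OF linear_J]

lemmas g_simps [simp] = bilinear_ladd[OF bilinear_g] bilinear_radd[OF bilinear_g]
  bilinear_lsub[OF bilinear_g] bilinear_rsub[OF bilinear_g]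
  bilinear_lneg[OF bilinear_g] bilinear_rneg[OF bilinear_g]
  bilinear_lmul[OF bilinear_g] bilinear_rmul[OF bilinear_g]
  bilinear_lzero[OF bilinear_g] bilinear_rzero[OF bilinear_g]

lemma g_J_right: "g x (J y) = - g (J x) y"
  using g_J_J[of x "J y"] by simp

lemma g_J_self [simp]: "g (J x) x = 0" "g x (J x) = 0"
  using g_J_right[of x x] g_sym[of x "J x"] by auto

lemma g_zero_iff [simp]: "g x x = 0 \<longleftrightarrow> x = 0"
  by (cases "x = 0") (use g_pos[of x] in auto)

lemma g_nonneg: "g x x \<ge> 0"
  using g_pos[of x] by (cases "x = 0") auto

definition w :: "'a \<Rightarrow> 'a \<Rightarrow> real" where "w x y = g (J x) y"

lemma w_skew: "w x y = - w y x"
  unfolding w_def using g_J_right[of y x] g_sym[of y "J x"] by simp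

lemma bilinear_w: "bilinear w"
  by (simp add: bilinear_def linear_iff w_def)

lemma w_simps [simp]: "w x (J y) = g x y" "w (J x) y = - g x y" "w x x = 0"
  by (simp_all add: w_def)

lemma kaehler_form_conv: "kaehler_form J g = two_form w"
  by (simp add: fun_eq_iff kaehler_form_def two_form_def w_def)

abbreviation Om :: "nat \<Rightarrow> 'a form" where "Om m \<equiv> wedge_power (two_form w) m"

lemma Om_swap: "Om m (x # y # zs) = - Om m (y # x # zs)"
  by (rule wedge_power_two_form_swap, rule w_skew)

lemma wedge_one_form_vanish: "(\<And>y. y \<in> set ys \<Longrightarrow> \<phi> y = 0) \<Longrightarrow> wedge (one_form \<phi>) \<beta> ys = 0"
  unfolding wedge_one_form by (subst delsum_cong[of _ _ "\<lambda>z zs. 0"]) (auto simp: delsum_zero)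

lemma Om_Cons_vanish: "(\<And>y. y \<in> set ys \<Longrightarrow> w x y = 0) \<Longrightarrow> Om m (x # ys) = 0"
  by (cases m) (simp_all add: wedge_power_two_form_Cons wedge_one_form_vanish wedge_power_0 form_one_def)

lemma Om_Cons_Cons:
  assumes "\<And>y. y \<in> set ys \<Longrightarrow> w x y = 0"
  shows "Om (Suc m) (x # v # ys) = of_nat (Suc m) * of_real (w x v) * Om m ys"
  using assms by (simp add: wedge_power_two_form_Cons wedge_one_form_Cons wedge_one_form_vanish)

lemma unitary_Cons_orthogonal:
  assumes "unitary J g (e # es)" and "y \<in> set (pairs J es)"
  shows "w e y = 0" "w (J e) y = 0"
  using assms by (auto simp: set_pairs w_def g_J_right)

text \<open>\<omega>^n is n! times the volume form; each pair splits off with the value 1 of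
  \<omega> on (e, J e).\<close>

lemma Om_pairs: "unitary J g es \<Longrightarrow> Om (length es) (pairs J es) = fact (length es)"
proof (induction es)
  case Nil thus ?case by (simp add: wedge_power_def form_one_def)
next
  case (Cons e es)
  have "Om (Suc (length es)) (e # J e # pairs J es)
    = of_nat (Suc (length es)) * of_real (w e (J e)) * Om (length es) (pairs J es)"
    by (rule Om_Cons_Cons) (rule unitary_Cons_orthogonal[OF Cons.prems])
  thus ?case using Cons by simp
qed

text \<open>Deleting two vectors from different pairs leaves some \<open>e\<close> or
  \<open>J e\<close> without its partner, which kills the power of \<omega>. Only deletions of whole
  pairs survive, and their adjacent positions give the sign -1.\<close>

lemma pairsum_Om:
  fixes c :: "'a \<Rightarrow> 'a \<Rightarrow> real"
  assumes "unitary J g es" "length es = Suc m"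
  shows "pairsum (\<lambda>a b zs. of_real (c a b) * Om m zs) (pairs J es) = - fact m * (\<Sum>e\<leftarrow>es. of_real (c e (J e)))"
  using assms
proof (induction es arbitrary: m)
  case (Cons e es)
  note o = unitary_Cons_orthogonal[OF Cons.prems(1)]
  define ys where "ys = pairs J es"
  have v: "Om m (J e # zs) = 0" "Om m (e # zs) = 0" if "set zs \<subseteq> set ys" for zs
    by (rule Om_Cons_vanish; use that o ys_def in blast)+
  have d: "delsum (\<lambda>z zs. of_real (c e z) * Om m (J e # zs)) ys = 0"
    "delsum (\<lambda>z zs. of_real (c (J e) z) * Om m (e # zs)) ys = 0"
    by (subst delsum_cong[of _ _ "\<lambda>z zs. 0"]; simp add: v delsum_zero)+
  have p: "pairsum (\<lambda>a b zs. of_real (c a b) * Om m (e # J e # zs)) ys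
    = - fact m * (\<Sum>e\<leftarrow>es. of_real (c e (J e)))"
  proof (cases m)
    case 0
    hence "es = []" using Cons.prems by simp
    thus ?thesis by (simp add: ys_def)
  next
    case (Suc k)
    have "Om m (e # J e # zs) = of_nat m * Om k zs" if "set zs \<subseteq> set ys" for zs
      using Om_Cons_Cons[of zs e k "J e"] o that Cons.prems unfolding Suc ys_def by auto
    hence "pairsum (\<lambda>a b zs. of_real (c a b) * Om m (e # J e # zs)) ys
      = pairsum (\<lambda>a b zs. of_nat m * (of_real (c a b) * Om k zs)) ys"
      by (intro pairsum_cong) simp
    also have "\<dots> = of_nat m * (- fact k * (\<Sum>e\<leftarrow>es. of_real (c e (J e))))"
      unfolding pairsum_cmult ys_def using Cons Suc by simp
    finally show ?thesis using Suc by (simp add: algebra_simps)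
  qed
  have "Om m ys = fact m" using Om_pairs[of es] Cons.prems unfolding ys_def by simp
  thus ?case using d p by (simp add: ys_def[symmetric] algebra_simps)
qed simp

text \<open>The partner of the deleted vector \<open>z\<close> can only be paired with the component
  of \<open>X z\<close> along \<open>z\<close>. The result is \<open>fact m\<close> times the trace
  of \<open>X\<close> over the frame.\<close>

lemma delsum_Om:
  fixes X :: "'a \<Rightarrow> 'a"
  assumes "unitary J g es" "length es = m"
  shows "delsum (\<lambda>z zs. Om m (X z # zs)) (pairs J es)
    = fact m * (\<Sum>e\<leftarrow>es. of_real (g (X e) e + g (X (J e)) (J e)))"
  using assms
proof (induction es arbitrary: m)
  case (Cons e es)
  note o = unitary_Cons_orthogonal[OF Cons.prems(1)]
  define ys where "ys = pairs J es"
  obtain k where k: "m = Suc k" "length es = k" using Cons.prems by auto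
  have Oy: "Om k ys = fact k" using Om_pairs[of es] Cons.prems k unfolding ys_def by simp
  have a: "Om m (X e # J e # ys) = of_nat m * of_real (g (X e) e) * Om k ys"
    using Om_Cons_Cons[of ys "J e" k "X e"] o unfolding k ys_def
    by (subst Om_swap) (simp add: g_sym)
  have b: "Om m (X (J e) # e # ys) = - of_nat m * of_real (g (X (J e)) (J e)) * Om k ys"
  proof -
    have "w e (X (J e)) = g (X (J e)) (J e)" unfolding w_def by (rule g_sym)
    thus ?thesis using Om_Cons_Cons[of ys "e" k "X (J e)"] o unfolding k ys_def
      by (subst Om_swap) (simp add: algebra_simps)
  qed
  have c: "Om m (v # e # J e # zs) = of_nat m * Om k (v # zs)" if "set zs \<subseteq> set ys" for zs v
  proof -
    have z: "w e z = 0" "w (J e) z = 0" if "z \<in> set zs" for z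
      using o \<open>set zs \<subseteq> set ys\<close> that by (auto simp: ys_def)
    have "Om m (e # v # J e # zs) = of_nat m * wedge (one_form (w e)) (Om k) (v # J e # zs)"
      unfolding k wedge_power_two_form_Cons ..
    also have "\<dots> = - of_nat m * of_real (w e (J e)) * Om k (v # zs)"
      using z Om_Cons_vanish[of zs "J e" k]
      by (simp add: wedge_one_form_Cons wedge_one_form_vanish[of zs])
    finally show ?thesis using Cons.prems by (subst Om_swap) simp
  qed
  have "delsum (\<lambda>z zs. Om m (X z # e # J e # zs)) ys = delsum (\<lambda>z zs. of_nat m * Om k (X z # zs)) ys"
    by (rule delsum_cong) (rule c)
  also have "\<dots> = of_nat m * (fact k * (\<Sum>e\<leftarrow>es. of_real (g (X e) e + g (X (J e)) (J e))))"
    unfolding delsum_cmult ys_def using Cons k by simp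
  finally show ?case using a b Oy k by (simp add: ys_def[symmetric] algebra_simps)
qed simp

end

section \<open>The balanced condition\<close>

text \<open>\<open>expand\<close> decomposes the identity into rank one maps; composing with
  \<open>f\<close> and adding the traces of the rank one summands gives the formula.\<close>

lemma linear_trace_dual_basis:
  fixes f :: "'a::euclidean_space \<Rightarrow> 'a"
  assumes f: "linear f" and \<phi>: "\<And>i. i \<in> I \<Longrightarrow> linear (\<phi> i)"
    and expand: "\<And>x. x = (\<Sum>i\<in>I. \<phi> i x *\<^sub>R b i)"
  shows "linear_trace f = (\<Sum>i\<in>I. \<phi> i (f (b i)))"
proof -
  have "linear_trace f = (\<Sum>c\<in>Basis. \<Sum>i\<in>I. \<phi> i (f c) * (b i \<bullet> c))"
    unfolding linear_trace_def
    by (rule sum.cong[OF refl], subst expand) (simp add: inner_sum_left)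
  also have "\<dots> = (\<Sum>i\<in>I. \<Sum>c\<in>Basis. \<phi> i (f ((b i \<bullet> c) *\<^sub>R c)))"
    by (subst sum.swap) (auto intro!: sum.cong simp: linear_scale[OF f] linear_scale[OF \<phi>])
  also have "\<dots> = (\<Sum>i\<in>I. \<phi> i (f (b i)))"
    by (rule sum.cong[OF refl])
       (simp only: linear_sum[OF \<phi>, symmetric] linear_sum[OF f, symmetric] euclidean_representation)
  finally show ?thesis .
qed

lemma linear_trace_dual_basis_list:
  fixes f :: "'a::euclidean_space \<Rightarrow> 'a"
  assumes f: "linear f" and \<phi>: "\<And>i. i \<in> set is \<Longrightarrow> linear (\<phi> i)"
    and expand: "\<And>x. x = (\<Sum>i\<leftarrow>is. \<phi> i x *\<^sub>R b i)"
  shows "linear_trace f = (\<Sum>i\<leftarrow>is. \<phi> i (f (b i)))"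
proof -
  have "linear_trace f = (\<Sum>k\<in>{0..<length is}. \<phi> (is ! k) (f (b (is ! k))))"
    by (rule linear_trace_dual_basis[OF f]) (use \<phi> expand in \<open>auto simp: sum_list_sum_nth\<close>)
  thus ?thesis by (simp add: sum_list_sum_nth)
qed

lemma linear_trace_id: "linear_trace (\<lambda>x::'a::euclidean_space. x) = real DIM('a)"
  by (simp add: linear_trace_def)

locale lie_algebra =
  fixes br :: "'a::euclidean_space \<Rightarrow> 'a \<Rightarrow> 'a"
  assumes lie: "lie_bracket br"
begin

lemma bilinear_br: "bilinear br" and br_self [simp]: "br x x = 0"
  and jacobi: "br x (br y z) + br y (br z x) + br z (br x y) = 0"
  using lie by (auto simp: lie_bracket_def)

lemmas br_simps [simp] = bilinear_ladd[OF bilinear_br] bilinear_radd[OF bilinear_br]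
  bilinear_lsub[OF bilinear_br] bilinear_rsub[OF bilinear_br]
  bilinear_lneg[OF bilinear_br] bilinear_rneg[OF bilinear_br]
  bilinear_lmul[OF bilinear_br] bilinear_rmul[OF bilinear_br]
  bilinear_lzero[OF bilinear_br] bilinear_rzero[OF bilinear_br]

lemma br_skew: "br x y = - br y x"
proof -
  have "0 = br (x + y) (x + y)" by (simp only: br_self)
  also have "\<dots> = br x y + br y x"
    by (simp only: bilinear_ladd[OF bilinear_br] bilinear_radd[OF bilinear_br]) simp
  finally show ?thesis unfolding eq_neg_iff_add_eq_0 by (rule sym)
qed

lemma linear_br: "linear (br x)"
  using bilinear_br by (simp add: bilinear_def)

end

context hermitian
begin

text \<open>Completeness is phrased as the expansion formula, the form in which
  \<open>linear_trace_dual_basis_list\<close> uses it.\<close>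

definition frame :: "'a list \<Rightarrow> bool" where
  "frame es \<longleftrightarrow> unitary J g es \<and> (\<forall>x. x = (\<Sum>u\<leftarrow>pairs J es. g x u *\<^sub>R u))"

lemma frameD: "frame es \<Longrightarrow> unitary J g es" "frame es \<Longrightarrow> x = (\<Sum>u\<leftarrow>pairs J es. g x u *\<^sub>R u)"
  by (auto simp: frame_def)

lemma unitary_append:
  "unitary J g (xs @ ys) \<longleftrightarrow> unitary J g xs \<and> unitary J g ys
    \<and> (\<forall>x\<in>set xs. \<forall>y\<in>set ys. g x y = 0 \<and> g x (J y) = 0)"
  by (induction xs) auto

lemma pairs_append: "pairs J (xs @ ys) = pairs J xs @ pairs J ys"
  by (induction xs) auto

lemma g_orthogonal_sym: "g x y = 0 \<Longrightarrow> g x (J y) = 0 \<Longrightarrow> g y x = 0 \<and> g y (J x) = 0"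
  by (metis g_J_right g_sym minus_equation_iff neg_equal_0_iff_equal)

text \<open>With \<open>frame_rotate\<close> this brings any vector of a frame, or its image under
  \<open>J\<close>, to the head, where \<open>balanced_component\<close> applies.\<close>

lemma frame_move: "frame (xs @ e # ys) \<Longrightarrow> frame (e # xs @ ys)"
  by (auto simp: frame_def unitary_append pairs_append algebra_simps dest: g_orthogonal_sym)

lemma frame_rotate: "frame (e # es) \<Longrightarrow> frame (J e # es)"
  by (auto simp: frame_def algebra_simps g_J_right)

lemma linear_trace_frame:
  assumes "frame es" "linear f"
  shows "linear_trace f = (\<Sum>u\<leftarrow>pairs J es. g (f u) u)"
  by (rule linear_trace_dual_basis_list[OF assms(2), where \<phi> = "\<lambda>u x. g x u" and b = "\<lambda>u. u"])
     (auto simp: linear_iff intro: frameD(2)[OF assms(1)])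

lemma DIM_frame:
  assumes "frame es" shows "DIM('a) = 2 * length es"
proof -
  have "(\<Sum>u\<leftarrow>pairs J xs. g u u) = real (2 * length xs)" if "unitary J g xs" for xs
    using that by (induction xs) auto
  thus ?thesis using linear_trace_frame[OF assms, of "\<lambda>x. x"] frameD(1)[OF assms]
    by (simp add: linear_trace_id linear_iff)
qed

lemma sum_list_pairs: "(\<Sum>u\<leftarrow>pairs J es. F u) = (\<Sum>e\<leftarrow>es. F e + F (J e))"
  for F :: "'a \<Rightarrow> 'b::ab_group_add"
  by (induction es) (auto simp: algebra_simps)

end

locale hermitian_lie_algebra = hermitian J g + lie_algebra br
  for J :: "'a::euclidean_space \<Rightarrow> 'a" and g and br :: "'a \<Rightarrow> 'a \<Rightarrow> 'a"
begin

text \<open>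
  Obtained by evaluating \<open>d(\<omega>\<^sup>n\<^sup>-\<^sup>1)\<close> on \<open>x\<close> and the pairs \<open>e, J e\<close> of the remaining frame vectors.
  Brackets within a pair contribute to the left-hand side; brackets with \<open>x\<close> contribute the trace of
  \<open>ad x\<close>, which vanishes.
\<close>

lemma balanced_component:
  assumes bal: "balanced br J g" and uni: "unimodular br" and F: "frame (x # es)"
  shows "(\<Sum>e\<leftarrow>x # es. w x (br e (J e))) = 0"
proof -
  define ys where "ys = pairs J es"
  define m where "m = length es"
  note un = frameD(1)[OF F]
  have wx: "w x y = 0" if "y \<in> set ys" for y
    using unitary_Cons_orthogonal(1)[OF un] that by (simp add: ys_def)
  \<comment> \<open>The frame has n vectors and \<open>es\<close> omits \<open>x\<close>, so its
    length is n - 1, the exponent in the balanced condition.\<close>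
  have "DIM('a) div 2 - 1 = m"
    using DIM_frame[OF F] by (simp add: m_def)
  hence "0 = ce_diff br (Om m) (x # ys)"
    using bal by (simp add: balanced_def kaehler_form_conv)
  also have "\<dots> = pairsum (\<lambda>a b zs. Om m (br a b # x # zs)) ys - delsum (\<lambda>z zs. Om m (br x z # zs)) ys"
    by (simp add: ce_diff_conv_pairsum)
  also have "delsum (\<lambda>z zs. Om m (br x z # zs)) ys
      = fact m * (\<Sum>e\<leftarrow>es. of_real (g (br x e) e + g (br x (J e)) (J e)))"
    unfolding ys_def by (rule delsum_Om) (use un m_def in auto)
  also have "pairsum (\<lambda>a b zs. Om m (br a b # x # zs)) ys
      = fact m * (\<Sum>e\<leftarrow>es. of_real (w x (br e (J e))))"
  proof (cases m)
    case 0 thus ?thesis by (simp add: ys_def m_def)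
  next
    case (Suc k)
    have "pairsum (\<lambda>a b zs. Om m (br a b # x # zs)) ys
      = pairsum (\<lambda>a b zs. - of_nat m * (of_real (w x (br a b)) * Om k zs)) ys"
    proof (rule pairsum_cong)
      fix a b zs assume "set zs \<subseteq> set ys"
      hence "Om (Suc k) (x # br a b # zs) = of_nat (Suc k) * of_real (w x (br a b)) * Om k zs"
        by (intro Om_Cons_Cons wx) auto
      thus "Om m (br a b # x # zs) = - of_nat m * (of_real (w x (br a b)) * Om k zs)"
        unfolding Suc by (subst Om_swap) (simp add: algebra_simps)
    qed
    also have "\<dots> = - of_nat m * (- fact k * (\<Sum>e\<leftarrow>es. of_real (w x (br e (J e)))))"
      unfolding pairsum_cmult ys_def by (subst pairsum_Om) (use un m_def Suc in auto)
    finally show ?thesis using Suc by (simp add: algebra_simps)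
  qed
  finally have "fact m * ((\<Sum>e\<leftarrow>es. of_real (w x (br e (J e))))
    - (\<Sum>e\<leftarrow>es. of_real (g (br x e) e + g (br x (J e)) (J e)))) = (0::complex)"
    by (simp add: right_diff_distrib)
  hence "(\<Sum>e\<leftarrow>es. complex_of_real (w x (br e (J e))))
      = (\<Sum>e\<leftarrow>es. of_real (g (br x e) e + g (br x (J e)) (J e)))"
    by simp
  moreover have "(\<Sum>e\<leftarrow>es. complex_of_real (F e)) = of_real (\<Sum>e\<leftarrow>es. F e)" for F
    by (induction es) auto
  ultimately have *: "(\<Sum>e\<leftarrow>es. w x (br e (J e))) = (\<Sum>e\<leftarrow>es. g (br x e) e + g (br x (J e)) (J e))"
    by (simp only: of_real_eq_iff)
  have "0 = linear_trace (br x)" using uni by (simp add: unimodular_def)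
  also have "\<dots> = g (br x (J x)) (J x) + (\<Sum>e\<leftarrow>es. g (br x e) e + g (br x (J e)) (J e))"
    by (subst linear_trace_frame[OF F linear_br]) (simp add: sum_list_pairs)
  \<comment> \<open>\<open>J x\<close> is not among the arguments of the form; its contribution to
    the trace is the summand of the claim that belongs to \<open>x\<close> itself.\<close>
  also have "g (br x (J x)) (J x) = w x (br x (J x))" by (simp add: w_def g_sym)
  finally show ?thesis using * by simp
qed

text \<open>Replacing \<open>e\<close> by \<open>J e\<close> leaves the summand
  \<open>br e (J e)\<close> unchanged, so \<open>balanced_component\<close> at \<open>e\<close> and
  at \<open>J e\<close> kills the components of the sum along both vectors.\<close>

theorem balanced_frame_sum:
  assumes bal: "balanced br J g" and uni: "unimodular br" and F: "frame es"
  shows "(\<Sum>e\<leftarrow>es. br e (J e)) = 0"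
proof -
  let ?S = "\<lambda>es. (\<Sum>e\<leftarrow>es. br e (J e))"
  have w_sum: "w x (?S es) = (\<Sum>e\<leftarrow>es. w x (br e (J e)))" for x es
    by (induction es) (auto simp: w_def)
  have z: "g (?S es) e = 0 \<and> g (?S es) (J e) = 0" if e: "e \<in> set es" for e
  proof -
    obtain xs ys where es: "es = xs @ e # ys" using split_list[OF e] by blast
    have F1: "frame (e # xs @ ys)" using F frame_move unfolding es by blast
    have F2: "frame (J e # xs @ ys)" using F1 frame_rotate by blast
    have S1: "?S es = ?S (e # xs @ ys)" unfolding es by (simp add: algebra_simps)
    have S2: "?S (e # xs @ ys) = ?S (J e # xs @ ys)" using br_skew[of e "J e"] by simp
    have "w e (?S es) = 0"
      unfolding S1 w_sum by (rule balanced_component[OF bal uni F1])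
    moreover have "w (J e) (?S es) = 0"
      unfolding S1 S2 w_sum by (rule balanced_component[OF bal uni F2])
    ultimately show ?thesis by (simp add: w_def g_sym)
  qed
  have "?S es = (\<Sum>u\<leftarrow>pairs J es. g (?S es) u *\<^sub>R u)" by (rule frameD(2)[OF F])
  also have "\<dots> = (\<Sum>u\<leftarrow>pairs J es. 0)"
    by (rule arg_cong[where f = sum_list], rule map_cong) (use z in \<open>auto simp: set_pairs\<close>)
  finally show ?thesis by simp
qed

end

section \<open>Bidegree and the pluriclosed condition\<close>

lemma map_upt_Suc_shift: "map f [0..<Suc n] = f 0 # map (\<lambda>k. f (Suc k)) [0..<n]"
  by (simp add: upt_conv_Cons map_Suc_upt[symmetric] del: upt_Suc)

lemma complexify_Cons:
  "complexify \<alpha> (z # zs) = complexify (\<lambda>ys. \<alpha> (fst z # ys) + \<i> * \<alpha> (snd z # ys)) zs"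
proof -
  have "card (Suc ` T) = card T" for T by (simp add: card_image)
  moreover have "card (insert 0 (Suc ` T)) = Suc (card T)" if "T \<in> Pow {..<length zs}" for T
    using that finite_subset[of T] by (auto simp: card_image)
  ultimately show ?thesis
    unfolding complexify_def list.size(4) add_Suc_right add_0_right sum_Pow_lessThan_Suc map_upt_Suc_shift
    nth_Cons_Suc nth_Cons_0
    by (simp add: image_iff sum.distrib[symmetric] algebra_simps)
qed

text \<open>Each argument is projected in turn to type (1,0) or (0,1), and \<open>p\<close> counts
  the (1,0) projections still to be made. On lists of fixed length this unfolds by
  simplification.\<close>

fun bidegree_eval :: "('a::real_vector \<Rightarrow> 'a) \<Rightarrow> nat \<Rightarrow> 'a form \<Rightarrow> 'a list \<Rightarrow> complex" where
  "bidegree_eval J p \<alpha> [] = (if p = 0 then \<alpha> [] else 0)"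
| "bidegree_eval J p \<alpha> (x # xs) =
    (if p = 0 then 0 else
      bidegree_eval J (p - 1) (\<lambda>ys. \<alpha> ((1/2) *\<^sub>R x # ys) + \<i> * \<alpha> (- (1/2) *\<^sub>R J x # ys)) xs)
    + bidegree_eval J p (\<lambda>ys. \<alpha> ((1/2) *\<^sub>R x # ys) + \<i> * \<alpha> ((1/2) *\<^sub>R J x # ys)) xs"

lemma bidegree_part_conv_eval:
  "bidegree_part J p q \<alpha> xs = (if length xs = p + q then bidegree_eval J p \<alpha> xs else 0)"
proof -
  define G where "G p \<alpha> xs = (\<Sum>S\<in>Pow {..<length xs}. if card S = p then complexify \<alpha>
    (map (\<lambda>k. if k \<in> S then proj10 J (xs ! k) else proj01 J (xs ! k)) [0..<length xs]) else 0)"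
    for p \<alpha> xs
  have "G p \<alpha> xs = bidegree_eval J p \<alpha> xs"
  proof (induction xs arbitrary: p \<alpha>)
    case Nil thus ?case by (simp add: G_def complexify_def)
  next
    case (Cons x xs)
    have c1: "card (Suc ` T) = card T" for T by (simp add: card_image)
    have c2: "card (insert 0 (Suc ` T)) = Suc (card T)" if "T \<in> Pow {..<length xs}" for T
      using that finite_subset[of T] by (auto simp: card_image)
    have "G p \<alpha> (x # xs) = G p (\<lambda>ys. \<alpha> ((1/2) *\<^sub>R x # ys) + \<i> * \<alpha> ((1/2) *\<^sub>R J x # ys)) xs
      + (if p = 0 then 0 else G (p - 1) (\<lambda>ys. \<alpha> ((1/2) *\<^sub>R x # ys) + \<i> * \<alpha> (- (1/2) *\<^sub>R J x # ys)) xs)"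
      unfolding G_def list.size(4) add_Suc_right add_0_right sum_Pow_lessThan_Suc map_upt_Suc_shift
      nth_Cons_Suc nth_Cons_0
      using c1 c2 by (cases p)
        (simp_all add: image_iff complexify_Cons proj10_def[of J x] proj01_def[of J x] cong: if_cong)
    thus ?case by (simp add: Cons.IH)
  qed
  moreover have *: "(\<Sum>S | S \<subseteq> {..<n} \<and> card S = p. F S) = (\<Sum>S\<in>Pow {..<n}. if card S = p then F S else 0)"
    for F :: "nat set \<Rightarrow> complex" and n
  proof -
    have e: "{S. S \<subseteq> {..<n} \<and> card S = p} = {S\<in>Pow {..<n}. card S = p}" by auto
    show ?thesis unfolding e by (rule sum.inter_filter) simp
  qed
  ultimately show ?thesis
  proof (cases "length xs = p + q")
    case True
    show ?thesis
      unfolding bidegree_part_def True[symmetric] \<open>G p \<alpha> xs = bidegree_eval J p \<alpha> xs\<close>[symmetric] G_def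
      by (simp add: *)
  qed (simp add: bidegree_part_def)
qed

text \<open>
  The hypothesis \<open>int\<close> says that the trilinear form \<open>D\<close> has no component of type \<open>(3,0)\<close> or \<open>(0,3)\<close>.
\<close>

lemma bidegree_eval_3:
  fixes D :: "'a::real_vector \<Rightarrow> 'a \<Rightarrow> 'a \<Rightarrow> complex"
  assumes s1: "\<And>c x y z. D (c *\<^sub>R x) y z = of_real c * D x y z"
    and s2: "\<And>c x y z. D x (c *\<^sub>R y) z = of_real c * D x y z"
    and s3: "\<And>c x y z. D x y (c *\<^sub>R z) = of_real c * D x y z"
    and J: "\<And>x. J (J x) = - x"
    and int: "\<And>x y z. D (J x) y z + D x (J y) z + D x y (J z) = D (J x) (J y) (J z)"
    and \<alpha>: "\<And>x y z. \<alpha> [x, y, z] = D x y z"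
  shows "bidegree_eval J 0 \<alpha> [x, y, z] = 0" "bidegree_eval J 3 \<alpha> [x, y, z] = 0"
    "bidegree_eval J 1 \<alpha> [x, y, z] = (D x y z + \<i> * D (J x) (J y) (J z)) / 2"
    "bidegree_eval J 2 \<alpha> [x, y, z] = (D x y z - \<i> * D (J x) (J y) (J z)) / 2"
proof -
  have n1: "D (- x) y z = - D x y z" "D x (- y) z = - D x y z" "D x y (- z) = - D x y z" for x y z
    using s1[of "-1"] s2[of _ "-1"] s3[of _ _ "-1"] by simp_all
  have r: "(3 * a + a + \<i> * (b + 3 * b)) / 8 = (a + \<i> * b) / 2"
    "(3 * a + a - \<i> * (b + 3 * b)) / 8 = (a - \<i> * b) / 2" for a b :: complex
    by (simp_all add: field_simps)
  have P: "D (J x) (J y) z + D (J x) y (J z) + D x (J y) (J z) = D x y z"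
    using int[of "J x" y z] J by (simp add: n1 algebra_simps)
  have "bidegree_eval J 1 \<alpha> [x, y, z]
    = (3 * D x y z + (D (J x) (J y) z + D (J x) y (J z) + D x (J y) (J z))
      + \<i> * ((D (J x) y z + D x (J y) z + D x y (J z)) + 3 * D (J x) (J y) (J z))) / 8"
    by (simp add: \<alpha> s1 s2 s3 n1) (simp add: algebra_simps)
  thus "bidegree_eval J 1 \<alpha> [x, y, z] = (D x y z + \<i> * D (J x) (J y) (J z)) / 2"
    unfolding P int r .
  have "bidegree_eval J 2 \<alpha> [x, y, z]
    = (3 * D x y z + (D (J x) (J y) z + D (J x) y (J z) + D x (J y) (J z))
      - \<i> * ((D (J x) y z + D x (J y) z + D x y (J z)) + 3 * D (J x) (J y) (J z))) / 8"
    by (simp add: \<alpha> s1 s2 s3 n1 numeral_2_eq_2) (simp add: algebra_simps)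
  thus "bidegree_eval J 2 \<alpha> [x, y, z] = (D x y z - \<i> * D (J x) (J y) (J z)) / 2"
    unfolding P int r .
  have "bidegree_eval J 0 \<alpha> [x, y, z]
    = (D x y z - (D (J x) (J y) z + D (J x) y (J z) + D x (J y) (J z))
      + \<i> * ((D (J x) y z + D x (J y) z + D x y (J z)) - D (J x) (J y) (J z))) / 8"
    by (simp add: \<alpha> s1 s2 s3 n1) (simp add: algebra_simps)
  thus "bidegree_eval J 0 \<alpha> [x, y, z] = 0"
    unfolding P int by (simp del: bidegree_eval.simps)
  have "bidegree_eval J 3 \<alpha> [x, y, z]
    = (D x y z - (D (J x) (J y) z + D (J x) y (J z) + D x (J y) (J z))
      - \<i> * ((D (J x) y z + D x (J y) z + D x y (J z)) - D (J x) (J y) (J z))) / 8"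
    by (simp add: \<alpha> s1 s2 s3 n1 numeral_3_eq_3) (simp add: algebra_simps)
  thus "bidegree_eval J 3 \<alpha> [x, y, z] = 0"
    unfolding P int by (simp del: bidegree_eval.simps)
qed

text \<open>
  Since \<open>u \<and> J u\<close> has type \<open>(1,1)\<close>, only the \<open>(2,2)\<close> component is seen on \<open>(x, J x, z, J z)\<close>.
\<close>

lemma bidegree_eval_2_2:
  fixes D :: "'a::real_vector \<Rightarrow> 'a \<Rightarrow> 'a \<Rightarrow> 'a \<Rightarrow> complex"
  assumes s1: "\<And>c x y z t. D (c *\<^sub>R x) y z t = of_real c * D x y z t"
    and s2: "\<And>c x y z t. D x (c *\<^sub>R y) z t = of_real c * D x y z t"
    and s3: "\<And>c x y z t. D x y (c *\<^sub>R z) t = of_real c * D x y z t"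
    and s4: "\<And>c x y z t. D x y z (c *\<^sub>R t) = of_real c * D x y z t"
    and a1: "\<And>x y z t. D x y z t = - D y x z t" and a3: "\<And>x y z t. D x y z t = - D x y t z"
    and J: "\<And>x. J (J x) = - x"
    and \<alpha>: "\<And>x y z t. \<alpha> [x, y, z, t] = D x y z t"
  shows "bidegree_eval J 2 \<alpha> [x, J x, z, J z] = D x (J x) z (J z)"
proof -
  have n: "D (- x) y z t = - D x y z t" "D x (- y) z t = - D x y z t"
    "D x y (- z) t = - D x y z t" "D x y z (- t) = - D x y z t" for x y z t
    using s1[of "-1"] s2[of _ "-1"] s3[of _ _ "-1"] s4[of _ _ _ "-1"] by simp_all
  have z: "D x x z t = 0" "D x y z z = 0" for x y z t
    using a1[of x x z t] a3[of x y z z] by simp_all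
  have sw: "D (J x) x z' t' = - D x (J x) z' t'" "D x' y' (J z) z = - D x' y' z (J z)" for z' t' x' y'
    by (rule a1 a3)+
  show ?thesis
    by (simp add: \<alpha> s1 s2 s3 s4 n z sw J numeral_2_eq_2)
qed

section \<open>Types of \<omega> and its derivatives\<close>

context hermitian_lie_algebra
begin

definition dw :: "'a \<Rightarrow> 'a \<Rightarrow> 'a \<Rightarrow> real" where
  "dw x y z = - w (br x y) z + w (br x z) y - w (br y z) x"

lemmas w_bilinear_simps = bilinear_ladd[OF bilinear_w] bilinear_radd[OF bilinear_w]
  bilinear_lsub[OF bilinear_w] bilinear_rsub[OF bilinear_w]
  bilinear_lneg[OF bilinear_w] bilinear_rneg[OF bilinear_w]
  bilinear_lmul[OF bilinear_w] bilinear_rmul[OF bilinear_w]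
  bilinear_lzero[OF bilinear_w] bilinear_rzero[OF bilinear_w]

lemma dw_simps:
  "dw (x + x') y z = dw x y z + dw x' y z" "dw x (y + y') z = dw x y z + dw x y' z"
  "dw x y (z + z') = dw x y z + dw x y z'" "dw (- x) y z = - dw x y z" "dw x (- y) z = - dw x y z"
  "dw x y (- z) = - dw x y z" "dw (c *\<^sub>R x) y z = c * dw x y z" "dw x (c *\<^sub>R y) z = c * dw x y z"
  "dw x y (c *\<^sub>R z) = c * dw x y z"
  by (simp_all add: dw_def w_bilinear_simps algebra_simps)

lemma dw_swap: "dw x y z = - dw y x z" "dw x y z = - dw x z y"
  using br_skew[of x y] br_skew[of y z] by (simp_all add: dw_def w_bilinear_simps)

lemma ce_diff_kaehler_form: "ce_diff br (two_form w) [x, y, z] = of_real (dw x y z)"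
  by (simp add: ce_diff_conv_pairsum two_form_def dw_def)

text \<open>Integrability excludes components of type (3,0) and (0,3): the Nijenhuis tensor of two
  arguments is paired with \<open>J\<close> of the third, and the three relations are
  combined.\<close>

lemma dw_integrable:
  assumes "complex_structure br J"
  shows "dw (J x) y z + dw x (J y) z + dw x y (J z) = dw (J x) (J y) (J z)"
proof -
  have N: "w (br x y - br (J x) (J y) + J (br (J x) y) + J (br x (J y))) (J z) = 0" for x y z
  proof -
    have "br x y - br (J x) (J y) + J (br (J x) y) + J (br x (J y)) = 0"
      using assms by (simp add: complex_structure_def)
    thus ?thesis by (simp add: w_bilinear_simps)
  qed
  show ?thesis using N[of x y z] N[of x z y] N[of y z x]
    by (simp add: dw_def w_bilinear_simps w_def g_J_right del: w_simps)
qed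

lemma bidegree_kaehler_form:
  "bidegree_part J p q (two_form w) = (if p = 1 \<and> q = 1 then two_form w else (\<lambda>xs. 0))"
proof (rule ext)
  fix xs :: "'a list"
  show "bidegree_part J p q (two_form w) xs = (if p = 1 \<and> q = 1 then two_form w else (\<lambda>xs. 0)) xs"
  proof (cases "length xs = p + q \<and> p + q = 2")
    case True
    then obtain x y where xs: "xs = [x, y]" by (auto simp: numeral_2_eq_2 length_Suc_conv)
    have J1: "g (J x) y = w x y" "g x (J y) = - w x y"
      by (simp_all add: w_def g_J_right)
    consider "p = 0" "q = 2" | "p = 1" "q = 1" | "p = 2" "q = 0" using True by fastforce
    thus ?thesis
      by cases (simp_all add: xs bidegree_part_conv_eval two_form_def w_bilinear_simps J1 numeral_2_eq_2,
          simp_all add: field_simps)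
  next
    case False
    have "bidegree_eval J p \<alpha> xs = 0" if "\<And>ys. length ys = length xs \<Longrightarrow> \<alpha> ys = 0" for \<alpha> :: "'a form" and p
      using that by (induction xs arbitrary: p \<alpha>) auto
    from this[of "two_form w" p] show ?thesis using False
      by (auto simp: bidegree_part_conv_eval two_form_def)
  qed
qed

text \<open>
  With \<open>C = d\<omega>(J\<cdot>, J\<cdot>, J\<cdot>)\<close> one has \<open>delbar \<omega> = (d\<omega> + \<i> C) / 2\<close>, so the imaginary part of
  \<open>del (delbar \<omega>)\<close> is half the \<open>(2,2)\<close> component of \<open>dC\<close>.
\<close>

lemma pluriclosed_pairs:
  assumes cs: "complex_structure br J" and pl: "pluriclosed br J g"
  defines "C \<equiv> \<lambda>x y z. dw (J x) (J y) (J z)"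
  shows "- C (br u (J u)) v (J v) + C (br u v) (J u) (J v) - C (br u (J v)) (J u) v
    - C (br (J u) v) u (J v) + C (br (J u) (J v)) u v - C (br v (J v)) u (J u) = 0"
proof -
  define E where "E x y z = (of_real (dw x y z) + \<i> * of_real (C x y z)) / 2" for x y z
  have set3: "{(p, q). p + q + 1 = length [x, y, z]} = {(0, 2), (1, 1), (2, 0)}" for x y z :: 'a
    by auto
  have set4: "{(p, q). p + q + 1 = length [x, y, z, t]} = {(0, 3), (1, 2), (2, 1), (3, 0)}" for x y z t :: 'a
    by auto
  have zero: "ce_diff br (\<lambda>xs. 0) = (\<lambda>xs. 0)" by (simp add: ce_diff_def fun_eq_iff)
  have bz: "bidegree_eval J p (\<lambda>xs. 0) xs = 0" for p and xs :: "'a list"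
    by (induction xs arbitrary: p) auto
  have D_int: "complex_of_real (dw (J x) y z) + of_real (dw x (J y) z) + of_real (dw x y (J z))
      = of_real (dw (J x) (J y) (J z))" for x y z
    using dw_integrable[OF cs, of x y z] by (metis of_real_add)
  have eta: "delbar br J (kaehler_form J g) [x, y, z] = E x y z" for x y z
  proof -
    have "delbar br J (kaehler_form J g) [x, y, z] = bidegree_eval J 1 (ce_diff br (two_form w)) [x, y, z]"
      unfolding delbar_def kaehler_form_conv set3
      by (simp add: bidegree_kaehler_form zero bidegree_part_conv_eval bz del: bidegree_eval.simps)
    also have "\<dots> = E x y z"
      unfolding E_def C_def
      by (rule bidegree_eval_3(3)[where D = "\<lambda>x y z. of_real (dw x y z)"])
         (simp_all add: dw_simps D_int ce_diff_kaehler_form)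
    finally show ?thesis .
  qed
  \<comment> \<open>\<open>E\<close> has type (1,2), on which \<open>J\<close> in all arguments acts
    as \<i> * (-\<i>)^2 = -\<i>. In \<open>e3\<close> this removes the (2,1) component.\<close>
  have JE: "E (J x) (J y) (J z) = - \<i> * E x y z" for x y z
    by (simp add: E_def C_def dw_simps algebra_simps)
  have E_int: "E (J x) y z + E x (J y) z + E x y (J z) = E (J x) (J y) (J z)" for x y z
  proof -
    have "C (J x) y z + C x (J y) z + C x y (J z) = C (J x) (J y) (J z)" for x y z
      using dw_integrable[OF cs, of "J x" "J y" "J z"] by (simp add: C_def)
    hence "complex_of_real (C (J x) y z) + of_real (C x (J y) z) + of_real (C x y (J z))
      = of_real (C (J x) (J y) (J z))" by (metis of_real_add)
    moreover have "E (J x) y z + E x (J y) z + E x y (J z)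
      = ((complex_of_real (dw (J x) y z) + of_real (dw x (J y) z) + of_real (dw x y (J z)))
      + \<i> * (complex_of_real (C (J x) y z) + of_real (C x (J y) z) + of_real (C x y (J z)))) / 2"
      by (simp add: E_def add_divide_distrib distrib_left)
    ultimately show ?thesis by (simp only: D_int) (simp add: E_def)
  qed
  have E_scale: "E (c *\<^sub>R x) y z = of_real c * E x y z" "E x (c *\<^sub>R y) z = of_real c * E x y z"
    "E x y (c *\<^sub>R z) = of_real c * E x y z" for c x y z
    by (simp_all add: E_def C_def dw_simps algebra_simps)
  have E_neg: "E (- x) y z = - E x y z" "E x (- y) z = - E x y z" "E x y (- z) = - E x y z" for x y z
    using E_scale(1)[of "-1"] E_scale(2)[of _ "-1"] E_scale(3)[of _ _ "-1"] by simp_all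
  note ev = bidegree_eval_3[where D = E and J = J and \<alpha> = "delbar br J (kaehler_form J g)",
      OF E_scale J_J E_int eta]
  have e3: "bidegree_eval J p (delbar br J (kaehler_form J g)) [x, y, z]
    = (if p = 1 then E x y z else 0)" if "p = 0 \<or> p = 1 \<or> p = 2 \<or> p = 3" for p x y z
    using that ev[of x y z] by (auto simp: JE simp del: bidegree_eval.simps)
  \<comment> \<open>\<open>T\<close> is the differential of \<open>E\<close> on four
    vectors.\<close>
  define T where "T x y z t = - E (br x y) z t + E (br x z) y t - E (br x t) y z - E (br y z) x t
    + E (br y t) x z - E (br z t) x y" for x y z t
  have ce: "ce_diff br (bidegree_part J p q (delbar br J (kaehler_form J g))) [x, y, z, t]
    = (if p = 1 then T x y z t else 0)"
    if "p = 0 \<and> q = 3 \<or> p = 1 \<and> q = 2 \<or> p = 2 \<and> q = 1 \<or> p = 3 \<and> q = 0" for p q x y z t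
    using that by (auto simp: ce_diff_conv_pairsum bidegree_part_conv_eval e3 T_def simp del: bidegree_eval.simps)
  have e0: "bidegree_eval J p \<alpha> [x, y, z, t] = 0" if "\<And>x y z t. \<alpha> [x, y, z, t] = 0" for \<alpha> p x y z t
    using that by simp
  have sw: "E x y z = - E x z y" for x y z
  proof -
    have "dw x y z = - dw x z y" "C x y z = - C x z y" unfolding C_def by (rule dw_swap)+
    thus ?thesis by (simp add: E_def field_simps)
  qed
  have Z: "bidegree_eval J k (ce_diff br (bidegree_part J p q (delbar br J (kaehler_form J g)))) [x, y, z, t] = 0"
    if "p = 0 \<and> q = 3 \<or> p = 2 \<and> q = 1 \<or> p = 3 \<and> q = 0" for k p q x y z t
    by (rule e0) (use that in \<open>auto simp: ce\<close>)
  have T_a: "T x y z t = - T y x z t" for x y z t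
    using br_skew[of x y] sw[of "br z t" x y] by (simp add: T_def E_neg)
  have T_c: "T x y z t = - T x y t z" for x y z t
    using br_skew[of z t] sw[of "br x y" z t] by (simp add: T_def E_neg)
  have "0 = del br J (delbar br J (kaehler_form J g)) [u, J u, v, J v]"
    using pl by (simp add: pluriclosed_def)
  also have "\<dots> = bidegree_eval J 2 (ce_diff br (bidegree_part J 1 2 (delbar br J (kaehler_form J g)))) [u, J u, v, J v]"
    unfolding del_def set4
    by (simp add: bidegree_part_conv_eval[of J _ _ "ce_diff _ _"] Z numeral_2_eq_2 del: bidegree_eval.simps)
  also have "\<dots> = T u (J u) v (J v)"
    by (rule bidegree_eval_2_2[where D = T, OF _ _ _ _ T_a T_c J_J])
       (simp_all add: ce T_def E_scale algebra_simps)
  finally have "Im (T u (J u) v (J v)) = 0" by simp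
  thus ?thesis by (simp add: T_def E_def)
qed

end

section \<open>Complex subspaces and block diagonal metrics\<close>

context hermitian
begin

definition subframe :: "'a set \<Rightarrow> 'a list \<Rightarrow> bool" where
  "subframe U es \<longleftrightarrow> unitary J g es \<and> set es \<subseteq> U \<and> (\<forall>x\<in>U. x = (\<Sum>u\<leftarrow>pairs J es. g x u *\<^sub>R u))"

lemma subframeD:
  assumes "subframe U es"
  shows "unitary J g es" "set es \<subseteq> U" "x \<in> U \<Longrightarrow> x = (\<Sum>u\<leftarrow>pairs J es. g x u *\<^sub>R u)"
  using assms by (auto simp: subframe_def)

lemma set_pairs_subset: "set es \<subseteq> U \<Longrightarrow> J ` U \<subseteq> U \<Longrightarrow> set (pairs J es) \<subseteq> U"
  by (auto simp: set_pairs)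

lemma linear_g: "linear (g x)" "linear (\<lambda>x. g x y)"
  by (simp_all add: linear_iff)

lemma linear_sum_list: "linear f \<Longrightarrow> f (\<Sum>u\<leftarrow>us. c u *\<^sub>R u) = (\<Sum>u\<leftarrow>us. c u *\<^sub>R f u)"
  for f :: "'a \<Rightarrow> 'b::real_vector"
  by (induction us) (simp_all add: linear_0 linear_add linear_scale)

lemma exists_unit:
  assumes "subspace U" "U \<noteq> {0}"
  obtains e where "e \<in> U" "g e e = 1"
proof -
  obtain x where x: "x \<in> U" "x \<noteq> 0" using assms subspace_0 by blast
  have "g ((1 / sqrt (g x x)) *\<^sub>R x) ((1 / sqrt (g x x)) *\<^sub>R x) = 1"
    using x(2) g_pos[OF x(2)] by simp
  thus thesis using that subspace_scale[OF assms(1) x(1)] by blast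
qed

text \<open>Complex Gram-Schmidt: a unit vector \<open>e\<close> and \<open>J e\<close> span a
  complex line, whose orthogonal complement \<open>V\<close> in \<open>U\<close> is again complex
  and two dimensions smaller.\<close>

lemma exists_subframe:
  assumes "subspace U" "J ` U \<subseteq> U"
  obtains es where "subframe U es" "dim U = 2 * length es"
proof -
  have "\<exists>es. subframe U es \<and> dim U = 2 * length es"
    using assms
  proof (induction "dim U" arbitrary: U rule: less_induct)
    case less
    show ?case
    proof (cases "U = {0}")
      case True thus ?thesis by (intro exI[of _ "[]"]) (auto simp: subframe_def)
    next
      case False
      obtain e where e: "e \<in> U" "g e e = 1" using exists_unit less.prems(1) False by blast
      have Je: "J e \<in> U" using less.prems e by auto
      define V where "V = {u \<in> U. g u e = 0 \<and> g u (J e) = 0}"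
      have V: "subspace V" using less.prems(1) by (auto simp: V_def subspace_def)
      have JV: "J ` V \<subseteq> V"
        using less.prems(2) by (auto simp: V_def g_J_right)
      have dec: "x - (g x e *\<^sub>R e + g x (J e) *\<^sub>R J e) \<in> V" if "x \<in> U" for x
        using that e Je by (auto simp: V_def intro!: subspace_diff subspace_add subspace_scale less.prems(1))
      have nJ: "J e \<notin> span V" using V e by (auto simp: span_eq_iff[THEN iffD2] V_def)
      have ne: "e \<notin> span (insert (J e) V)"
      proof
        assume "e \<in> span (insert (J e) V)"
        then obtain k where "e - k *\<^sub>R J e \<in> V" using V span_breakdown_eq[of e "J e" V] by (auto simp: span_eq_iff[THEN iffD2])
        thus False using e by (simp add: V_def)
      qed
      have "span (insert e (insert (J e) V)) = U"
      proof
        show "span (insert e (insert (J e) V)) \<subseteq> U"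
          using e Je less.prems(1) by (intro span_minimal) (auto simp: V_def)
        show "U \<subseteq> span (insert e (insert (J e) V))"
        proof
          fix x assume "x \<in> U"
          hence "(x - (g x e *\<^sub>R e + g x (J e) *\<^sub>R J e)) + (g x e *\<^sub>R e + g x (J e) *\<^sub>R J e)
            \<in> span (insert e (insert (J e) V))"
            by (intro span_add span_scale) (auto intro: span_base dec)
          thus "x \<in> span (insert e (insert (J e) V))" by simp
        qed
      qed
      hence "dim U = dim (insert e (insert (J e) V))" by (metis dim_span)
      hence dimU: "dim U = dim V + 2" using nJ ne by (simp add: dim_insert)
      then obtain es where es: "subframe V es" "dim V = 2 * length es"
        using less.hyps[of V] V JV by auto
      note D = subframeD[OF es(1)]
      have pV: "set (pairs J es) \<subseteq> V" by (rule set_pairs_subset[OF D(2) JV])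
      have "g e f = 0 \<and> g e (J f) = 0" if "f \<in> set es" for f
      proof -
        have "f \<in> V" "J f \<in> V" using that D(2) JV by auto
        thus ?thesis using g_sym[of e f] g_sym[of e "J f"] by (simp add: V_def)
      qed
      hence "unitary J g (e # es)" using D(1) e(2) by simp
      moreover have "x = (\<Sum>u\<leftarrow>pairs J (e # es). g x u *\<^sub>R u)" if "x \<in> U" for x
      proof -
        define y where "y = x - (g x e *\<^sub>R e + g x (J e) *\<^sub>R J e)"
        have "y = (\<Sum>u\<leftarrow>pairs J es. g y u *\<^sub>R u)" 
          unfolding y_def by (rule D(3)[OF dec[OF that]])
        also have "\<dots> = (\<Sum>u\<leftarrow>pairs J es. g x u *\<^sub>R u)"
        proof (intro arg_cong[where f = sum_list] map_cong refl)
          fix u assume "u \<in> set (pairs J es)"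
          hence "g u e = 0" "g u (J e) = 0" using pV by (auto simp: V_def)
          thus "g y u *\<^sub>R u = g x u *\<^sub>R u"
            using g_sym[of e u] g_sym[of "J e" u] by (simp add: y_def)
        qed
        finally have "x = g x e *\<^sub>R e + (g x (J e) *\<^sub>R J e + (\<Sum>u\<leftarrow>pairs J es. g x u *\<^sub>R u))"
          by (simp add: y_def algebra_simps)
        thus ?thesis by simp
      qed
      ultimately have "subframe U (e # es)" using e D(2) by (auto simp: subframe_def V_def)
      thus ?thesis using dimU es(2) by (intro exI[of _ "e # es"]) auto
    qed
  qed
  thus thesis using that by blast
qed

definition perp :: "'a set \<Rightarrow> 'a set" where "perp U = {x. \<forall>u\<in>U. g x u = 0}"

lemma subspace_perp: "subspace (perp U)"
  by (auto simp: perp_def subspace_def)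

lemma J_perp: "J ` U \<subseteq> U \<Longrightarrow> J ` perp U \<subseteq> perp U"
  using g_J_right by (force simp: perp_def image_subset_iff)

lemma unitary_sum_component:
  "unitary J g es \<Longrightarrow> v \<in> set (pairs J es) \<Longrightarrow> (\<Sum>u\<leftarrow>pairs J es. g x u * g u v) = g x v"
proof (induction es)
  case (Cons e es)
  have o: "g e v = 0" "g (J e) v = 0" "g v e = 0" "g v (J e) = 0" if "v \<in> set (pairs J es)" for v
    using unitary_Cons_orthogonal[OF Cons.prems(1) that] g_sym
    by (auto simp: w_def)
  have z: "(\<Sum>u\<leftarrow>pairs J es. g x u * g u v) = 0" if "v = e \<or> v = J e"
  proof -
    have "(\<Sum>u\<leftarrow>pairs J es. g x u * g u v) = (\<Sum>u\<leftarrow>pairs J es. 0)"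
      using that o by (intro arg_cong[where f = sum_list] map_cong) auto
    thus ?thesis by simp
  qed
  consider "v = e" | "v = J e" | "v \<in> set (pairs J es)" using Cons.prems by auto
  thus ?case
  proof cases
    case 3 thus ?thesis using Cons o by simp
  qed (use z Cons.prems in auto)
qed simp

lemma unitary_complete:
  assumes u: "unitary J g es" and c: "\<And>x. (\<And>v. v \<in> set (pairs J es) \<Longrightarrow> g x v = 0) \<Longrightarrow> x = 0"
  shows "frame es"
proof -
  have "x - (\<Sum>u\<leftarrow>pairs J es. g x u *\<^sub>R u) = 0" for x
    by (rule c) (simp add: linear_sum_list[OF linear_g(2)] unitary_sum_component[OF u])
  thus ?thesis using u by (simp add: frame_def)
qed

lemma perp_subframe:
  assumes "subframe U es" "\<And>v. v \<in> set (pairs J es) \<Longrightarrow> g x v = 0"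
  shows "x \<in> perp U"
  unfolding perp_def
proof (intro CollectI ballI)
  fix u assume "u \<in> U"
  have "g x (\<Sum>v\<leftarrow>pairs J es. g u v *\<^sub>R v) = (\<Sum>v\<leftarrow>pairs J es. 0)"
    unfolding linear_sum_list[OF linear_g(1)] using assms(2)
    by (intro arg_cong[where f = sum_list] map_cong) auto
  thus "g x u = 0" using subframeD(3)[OF assms(1) \<open>u \<in> U\<close>] by simp
qed

text \<open>Completeness of \<open>fs\<close> is asked as injectivity of its coordinates on
  \<open>perp U\<close>, which is easy to check for explicitly given vectors.\<close>

lemma frame_append:
  assumes U: "subframe U es" "J ` U \<subseteq> U" and fs: "unitary J g fs" "set fs \<subseteq> perp U"
    and c: "\<And>x. x \<in> perp U \<Longrightarrow> (\<And>v. v \<in> set (pairs J fs) \<Longrightarrow> g x v = 0) \<Longrightarrow> x = 0"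
  shows "frame (es @ fs)"
proof (rule unitary_complete)
  have "g e f = 0 \<and> g e (J f) = 0" if "e \<in> set es" "f \<in> set fs" for e f
  proof -
    have "f \<in> perp U" "J f \<in> perp U" using that fs(2) J_perp[OF U(2)] by auto
    thus ?thesis using that subframeD(2)[OF U(1)] by (auto simp: perp_def g_sym[of e])
  qed
  thus "unitary J g (es @ fs)" using subframeD(1)[OF U(1)] fs(1) by (simp add: unitary_append)
  fix x assume *: "\<And>v. v \<in> set (pairs J (es @ fs)) \<Longrightarrow> g x v = 0"
  have "x \<in> perp U" by (rule perp_subframe[OF U(1)]) (use * in \<open>auto simp: pairs_append\<close>)
  thus "x = 0" by (rule c) (use * in \<open>auto simp: pairs_append\<close>)
qed

lemma frame_append_perp:
  assumes "subframe U es" "J ` U \<subseteq> U" "subframe (perp U) fs"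
  shows "frame (es @ fs)"
proof (rule frame_append[OF assms(1,2)])
  fix x assume x: "x \<in> perp U" "\<And>v. v \<in> set (pairs J fs) \<Longrightarrow> g x v = 0"
  have "x \<in> perp (perp U)" by (rule perp_subframe[OF assms(3) x(2)])
  hence "g x x = 0" using x(1) by (simp add: perp_def)
  thus "x = 0" by simp
qed (use assms(3) in \<open>auto dest: subframeD\<close>)

lemma projection_perp:
  assumes "subframe U es" "subspace U" "J ` U \<subseteq> U"
  obtains u where "u \<in> U" "x - u \<in> perp U"
proof
  have p: "set (pairs J es) \<subseteq> U" by (rule set_pairs_subset[OF subframeD(2)[OF assms(1)] assms(3)])
  have "set us \<subseteq> U \<Longrightarrow> (\<Sum>u\<leftarrow>us. g x u *\<^sub>R u) \<in> U" for us
    by (induction us) (auto intro: subspace_0 subspace_add subspace_scale assms(2))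
  thus "(\<Sum>u\<leftarrow>pairs J es. g x u *\<^sub>R u) \<in> U" using p .
  show "x - (\<Sum>u\<leftarrow>pairs J es. g x u *\<^sub>R u) \<in> perp U"
    by (rule perp_subframe[OF assms(1)])
       (simp add: linear_sum_list[OF linear_g(2)] unitary_sum_component[OF subframeD(1)[OF assms(1)]])
qed

section \<open>The failure of an operator to preserve \<omega> infinitesimally\<close>

definition skew_defect :: "('a \<Rightarrow> 'a) \<Rightarrow> 'a \<Rightarrow> 'a \<Rightarrow> real" where
  "skew_defect X a b = w (X a) b + w a (X b)"

lemma skew_defect_skew: "skew_defect X a b = - skew_defect X b a"
  using w_skew[of "X a" b] w_skew[of a "X b"] by (simp add: skew_defect_def)

lemma bilinear_skew_defect:
  assumes "linear X" shows "linear (skew_defect X a)" "linear (\<lambda>a. skew_defect X a b)"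
  by (simp_all add: linear_iff skew_defect_def linear_add[OF assms] linear_scale[OF assms]
      bilinear_ladd[OF bilinear_w] bilinear_radd[OF bilinear_w] bilinear_lmul[OF bilinear_w]
      bilinear_rmul[OF bilinear_w] algebra_simps)

text \<open>
  Expand \<open>J (X u)\<close> in the frame and symmetrize the double sum in its two indices.
\<close>

lemma skew_defect_trace:
  assumes U: "subframe U es" "J ` U \<subseteq> U" and X: "linear X" "X ` U \<subseteq> U"
  defines "us \<equiv> pairs J es"
  shows "2 * (\<Sum>u\<leftarrow>us. skew_defect X (J (X u)) u)
    = - (\<Sum>i<length us. \<Sum>j<length us. (skew_defect X (us ! i) (us ! j))\<^sup>2)"
proof -
  let ?n = "length us" and ?s = "skew_defect X"
  have usU: "us ! i \<in> U" if "i < ?n" for i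
    using set_pairs_subset[OF subframeD(2)[OF U(1)] U(2)] that by (auto simp: us_def)
  have "?s (J (X u)) u = (\<Sum>v\<leftarrow>us. w (X u) v * ?s v u)" if "u \<in> U" for u
  proof -
    have "J (X u) \<in> U" using that U(2) X(2) by auto
    hence "?s (J (X u)) u = ?s (\<Sum>v\<leftarrow>us. g (J (X u)) v *\<^sub>R v) u"
      using subframeD(3)[OF U(1), of "J (X u)"] by (simp add: us_def)
    thus ?thesis by (simp add: linear_sum_list[OF bilinear_skew_defect(2)[OF X(1)]] w_def)
  qed
  hence T: "(\<Sum>u\<leftarrow>us. ?s (J (X u)) u) = (\<Sum>i<?n. \<Sum>j<?n. w (X (us ! i)) (us ! j) * ?s (us ! j) (us ! i))"
    using usU by (simp add: sum_list_sum_nth atLeast0LessThan)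
  also have "\<dots> = (\<Sum>i<?n. \<Sum>j<?n. w (X (us ! j)) (us ! i) * ?s (us ! i) (us ! j))"
    by (rule sum.swap)
  finally have T': "(\<Sum>u\<leftarrow>us. ?s (J (X u)) u)
    = (\<Sum>i<?n. \<Sum>j<?n. w (X (us ! j)) (us ! i) * ?s (us ! i) (us ! j))" .
  have step: "w (X a) b * ?s b a + w (X b) a * ?s a b = - (?s a b)\<^sup>2" for a b
    unfolding skew_defect_skew[of X b a] w_skew[of "X b" a]
    by (simp add: skew_defect_def power2_eq_square algebra_simps)
  have "2 * (\<Sum>u\<leftarrow>us. ?s (J (X u)) u)
    = (\<Sum>i<?n. \<Sum>j<?n. w (X (us ! i)) (us ! j) * ?s (us ! j) (us ! i)
      + w (X (us ! j)) (us ! i) * ?s (us ! i) (us ! j))"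
    using T T' by (simp add: sum.distrib)
  thus ?thesis by (simp add: step sum_negf)
qed

text \<open>Summing \<open>eq\<close> over a unitary frame of \<open>U\<close>,
  \<open>skew_defect_trace\<close> turns it into two sums of squares adding up to zero.
  \<open>X\<close> and \<open>Y\<close> are treated together because the pluriclosed condition
  controls only their combined contribution.\<close>

lemma skew_defect_vanish:
  assumes U: "subspace U" "J ` U \<subseteq> U"
    and X: "linear X" "X ` U \<subseteq> U" and Y: "linear Y" "Y ` U \<subseteq> U"
    and eq: "\<And>a. a \<in> U \<Longrightarrow> skew_defect X (J (X a)) a + skew_defect X (J (X (J a))) (J a)
      + skew_defect Y (J (Y a)) a + skew_defect Y (J (Y (J a))) (J a) = 0"
    and ab: "a \<in> U" "b \<in> U"
  shows "skew_defect X a b = 0" "skew_defect Y a b = 0"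
proof -
  obtain es where es: "subframe U es" using exists_subframe[OF U] by blast
  define us where "us = pairs J es"
  let ?n = "length us"
  let ?S = "\<lambda>X. \<Sum>i<?n. \<Sum>j<?n. (skew_defect X (us ! i) (us ! j))\<^sup>2"
  have "(\<Sum>u\<leftarrow>us. skew_defect X (J (X u)) u) + (\<Sum>u\<leftarrow>us. skew_defect Y (J (Y u)) u)
    = (\<Sum>e\<leftarrow>es. skew_defect X (J (X e)) e + skew_defect X (J (X (J e))) (J e)
      + skew_defect Y (J (Y e)) e + skew_defect Y (J (Y (J e))) (J e))"
    unfolding us_def sum_list_pairs sum_list_addf[symmetric]
    by (rule arg_cong[where f = sum_list]) (simp add: algebra_simps)
  also have "\<dots> = (\<Sum>e\<leftarrow>es. 0)"
    using eq subframeD(2)[OF es] by (intro arg_cong[where f = sum_list] map_cong) auto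
  finally have "?S X + ?S Y = 0"
    using skew_defect_trace[OF es U(2) X] skew_defect_trace[OF es U(2) Y] by (simp add: us_def)
  moreover have "?S X \<ge> 0" "?S Y \<ge> 0" by (intro sum_nonneg; simp)+
  ultimately have S: "?S X = 0" "?S Y = 0" by linarith+
  have "skew_defect Z a b = 0" if Z: "linear Z" "?S Z = 0" for Z
  proof -
    have z: "skew_defect Z (us ! i) (us ! j) = 0" if "i < ?n" "j < ?n" for i j
      using Z(2) that by (simp add: sum_nonneg_eq_0_iff sum_nonneg)
    hence z: "skew_defect Z u v = 0" if "u \<in> set us" "v \<in> set us" for u v
      using that by (metis in_set_conv_nth)
    have "skew_defect Z u b = (\<Sum>v\<leftarrow>us. g b v *\<^sub>R skew_defect Z u v)" for u
      using linear_sum_list[OF bilinear_skew_defect(1)[OF Z(1)], where c = "g b" and us = us]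
        subframeD(3)[OF es ab(2)] by (simp add: us_def)
    hence zb: "skew_defect Z u b = 0" if "u \<in> set us" for u
      using z[OF that] by (simp cong: map_cong)
    have "skew_defect Z a b = (\<Sum>u\<leftarrow>us. g a u *\<^sub>R skew_defect Z u b)"
      using linear_sum_list[OF bilinear_skew_defect(2)[OF Z(1)], where c = "g a" and us = us]
        subframeD(3)[OF es ab(1)] by (simp add: us_def)
    thus ?thesis using zb by (simp cong: map_cong)
  qed
  thus "skew_defect X a b = 0" "skew_defect Y a b = 0" using S X(1) Y(1) by blast+
qed

end

section \<open>A criterion for a block diagonal Kaehler metric\<close>

lemma ce_diff_two_form_other: "length xs \<noteq> 3 \<Longrightarrow> ce_diff br (two_form v) xs = 0"
  unfolding ce_diff_def
proof (intro sum.neutral ballI)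
  fix j i assume *: "length xs \<noteq> 3" "j \<in> {..<length xs}" "i \<in> {..<j}"
  hence "card ({..<length xs} - {i, j}) = length xs - 2" "length xs \<ge> 2" by (auto simp: card_Diff_subset)
  hence "length (br (xs ! i) (xs ! j) # nths xs ({..<length xs} - {i, j})) \<noteq> 2"
    using * by (simp add: length_nths_subset)
  thus "(-1) ^ (i + j) * two_form v (br (xs ! i) (xs ! j) # nths xs ({..<length xs} - {i, j})) = 0"
    unfolding two_form_def by (simp only: if_False mult_zero_right)
qed

context hermitian_lie_algebra
begin

lemma kaehler_if_dw_zero:
  assumes "\<And>x y z. dw x y z = 0" shows "kaehler br J g"
  unfolding kaehler_def kaehler_form_conv
proof
  fix xs :: "'a list"
  show "ce_diff br (two_form w) xs = 0"
  proof (cases "length xs = 3")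
    case True
    then obtain x y z where "xs = [x, y, z]" by (auto simp: numeral_3_eq_3 length_Suc_conv)
    thus ?thesis using assms by (simp add: ce_diff_kaehler_form)
  qed (rule ce_diff_two_form_other)
qed

text \<open>\<open>P\<close> projects onto an abelian ideal along a commuting complex complement.
  For the metric making the two blocks orthogonal, d\<omega> can only be nonzero on one complement
  vector and two ideal vectors, where it is the skew defect.\<close>

lemma kaehler_if_split:
  assumes P: "linear P" "\<And>x. P (J x) = J (P x)" "\<And>x. P (P x) = P x"
    and ab: "\<And>x y. br (P x) (P y) = 0" "\<And>x y. br (x - P x) (y - P y) = 0"
    and ideal: "\<And>x y. P (br x (P y)) = br x (P y)"
    and skew: "\<And>x a b. skew_defect (br (x - P x)) (P a) (P b) = 0"
  shows "\<exists>g'. compatible_metric J g' \<and> kaehler br J g'"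
proof -
  define g' where "g' x y = g (P x) (P y) + g (x - P x) (y - P y)" for x y
  note P_simps = linear_add[OF P(1)] linear_scale[OF P(1)] linear_diff[OF P(1)] linear_neg[OF P(1)]
  have "bilinear g'"
    by (simp add: bilinear_def linear_iff g'_def P_simps algebra_simps)
  moreover have "g' x y = g' y x" for x y by (simp add: g'_def g_sym)
  moreover have "g' x x > 0" if "x \<noteq> 0" for x
  proof -
    have "g' x x \<noteq> 0"
    proof
      assume "g' x x = 0"
      hence "g (P x) (P x) = 0 \<and> g (x - P x) (x - P x) = 0"
        unfolding g'_def using g_nonneg[of "P x"] g_nonneg[of "x - P x"] by linarith
      hence "P x = 0 \<and> x - P x = 0" unfolding g_zero_iff .
      thus False using that by (metis diff_zero)
    qed
    moreover have "g' x x \<ge> 0" unfolding g'_def by (intro add_nonneg_nonneg g_nonneg)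
    ultimately show ?thesis by simp
  qed
  moreover have "g' (J x) (J y) = g' x y" for x y
  proof -
    have "J x - P (J x) = J (x - P x)" for x by (simp add: P(2))
    thus ?thesis unfolding g'_def P(2) by (simp only: g_J_J)
  qed
  ultimately have c: "compatible_metric J g'"
    by (simp add: compatible_metric_def inner_product_def)
  interpret K: hermitian_lie_algebra J g' br
    by unfold_locales (use c linear_J lie in auto)
  have br_split: "br x y = br (x - P x) (P y) - br (y - P y) (P x)" for x y
  proof -
    have "br x y = br (P x + (x - P x)) (P y + (y - P y))" by simp
    also have "\<dots> = br (P x) (P y) + br (P x) (y - P y) + br (x - P x) (P y) + br (x - P x) (y - P y)"
      by (simp only: bilinear_ladd[OF bilinear_br] bilinear_radd[OF bilinear_br] add_ac)
    finally have "br x y = br (P x) (y - P y) + br (x - P x) (P y)"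
      by (simp only: ab add_0_left add_0_right)
    thus ?thesis unfolding br_skew[of "P x" "y - P y"] by (simp only: uminus_add_conv_diff)
  qed
  have Pw: "K.w v z = w v (P z)" if "P v = v" for v z
    using that by (simp add: K.w_def w_def g'_def P)
  have Pbr: "K.w (br (x - P x) (P y)) z = w (br (x - P x) (P y)) (P z)" for x y z
    by (rule Pw) (rule ideal)
  have "K.dw x y z = 0" for x y z
  proof -
    have e: "K.w (br x y) z = w (br (x - P x) (P y)) (P z) - w (br (y - P y) (P x)) (P z)" for x y z
      unfolding br_split[of x y] bilinear_lsub[OF K.bilinear_w] Pbr ..
    \<comment> \<open>Vanishing skew defect makes this expression symmetric in \<open>a\<close> and
      \<open>b\<close>, so the six terms of \<open>K.dw\<close> cancel in pairs.\<close>
    have s: "w (br (x - P x) (P a)) (P b) = w (br (x - P x) (P b)) (P a)" for x a b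
      using skew[of x a b] w_skew[of "P a" "br (x - P x) (P b)"] by (simp add: skew_defect_def)
    show ?thesis unfolding K.dw_def e using s[of x y z] s[of y x z] s[of z x y] by simp
  qed
  hence "kaehler br J g'" by (rule K.kaehler_if_dw_zero)
  thus ?thesis using c by blast
qed

end

section \<open>Abelian ideals of codimension two\<close>

context hermitian_lie_algebra
begin

lemma dw_abelian_ideal:
  assumes A: "abelian_on br A" and "a \<in> A" "b \<in> A"
  shows "dw a x b = skew_defect (br x) a b"
proof -
  have "br a b = 0" using assms by (simp add: abelian_on_def)
  thus ?thesis using br_skew[of a x] w_skew[of "br x b" a]
    by (simp add: dw_def skew_defect_def w_bilinear_simps)
qed

lemma dw_abelian: 
  assumes A: "abelian_on br A" and "a \<in> A" "b \<in> A" "c \<in> A"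
  shows "dw a b c = 0"
  using assms by (simp add: abelian_on_def dw_def w_bilinear_simps)

text \<open>In \<open>pluriclosed_pairs\<close> at (x, a) the four mixed brackets give skew defects.
  Membership is assumed for these brackets only, so that the lemma covers both an invariant
  \<open>A\<close> and vectors \<open>a\<close> of a smaller complex subspace.\<close>

lemma pluriclosed_ideal:
  assumes cs: "complex_structure br J" and pl: "pluriclosed br J g"
    and A: "abelian_on br A" and a: "a \<in> A" "J a \<in> A"
    and b: "J (br x a) \<in> A" "J (br x (J a)) \<in> A" "J (br (J x) a) \<in> A" "J (br (J x) (J a)) \<in> A"
  shows "dw (J (br x (J x))) (J a) a
    + (skew_defect (br x) (J (br x a)) a + skew_defect (br x) (J (br x (J a))) (J a)
      + skew_defect (br (J x)) (J (br (J x) a)) a + skew_defect (br (J x)) (J (br (J x) (J a))) (J a)) = 0"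
proof -
  have "br a (J a) = 0" using A a by (simp add: abelian_on_def)
  thus ?thesis using pluriclosed_pairs[OF cs pl, of x a]
    by (simp add: dw_simps dw_abelian_ideal[OF A b(1) a(1)] dw_abelian_ideal[OF A b(2) a(2)]
        dw_abelian_ideal[OF A b(3) a(1)] dw_abelian_ideal[OF A b(4) a(2)]) (simp add: dw_def w_bilinear_simps)
qed

lemma skew_defect_br_simps:
  "skew_defect (br (x + y)) a b = skew_defect (br x) a b + skew_defect (br y) a b"
  "skew_defect (br (x - y)) a b = skew_defect (br x) a b - skew_defect (br y) a b"
  "skew_defect (br (- x)) a b = - skew_defect (br x) a b"
  "skew_defect (br (c *\<^sub>R x)) a b = c * skew_defect (br x) a b"
  by (simp_all add: skew_defect_def w_bilinear_simps algebra_simps)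

end

text \<open>Gram-Schmidt for a semidefinite form: a null vector is orthogonal to everything, so it
  imposes no condition on the projection.\<close>

lemma exists_semidefinite_projection:
  fixes Q :: "'a::euclidean_space \<Rightarrow> 'a \<Rightarrow> real"
  assumes Q: "bilinear Q" "\<And>x y. Q x y = Q y x" "\<And>x. Q x x \<ge> 0" and U: "subspace U"
  obtains u where "u \<in> U" "\<And>w. w \<in> U \<Longrightarrow> Q (v - u) w = 0"
proof -
  note Qs = bilinear_ladd[OF Q(1)] bilinear_radd[OF Q(1)] bilinear_lsub[OF Q(1)] bilinear_rsub[OF Q(1)]
    bilinear_lmul[OF Q(1)] bilinear_rmul[OF Q(1)] bilinear_lzero[OF Q(1)] bilinear_rzero[OF Q(1)]
  have null: "Q x b = 0" if b: "Q b b = 0" for x b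
  proof (rule ccontr)
    assume n: "Q x b \<noteq> 0"
    \<comment> \<open>Chosen so that \<open>Q\<close> takes the value -1 at
      \<open>x + t *\<^sub>R b\<close>.\<close>
    define t where "t = - (Q x x + 1) / (2 * Q x b)"
    have "Q (x + t *\<^sub>R b) (x + t *\<^sub>R b) = Q x x + 2 * (t * Q x b)"
      using b Q(2)[of b x] by (simp add: Qs algebra_simps)
    also have "t * Q x b = - (Q x x + 1) / 2" using n by (simp add: t_def)
    finally have "Q (x + t *\<^sub>R b) (x + t *\<^sub>R b) = - 1" by (simp add: field_simps)
    thus False using Q(3)[of "x + t *\<^sub>R b"] by simp
  qed
  have "\<exists>u\<in>span S. \<forall>w\<in>span S. Q (v - u) w = 0" if "finite S" for S v
    using that
  proof (induction S arbitrary: v rule: finite_induct)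
    case empty thus ?case by (simp add: Qs)
  next
    case (insert b S)
    obtain c where c: "c \<in> span S" "\<And>w. w \<in> span S \<Longrightarrow> Q (b - c) w = 0" using insert.IH by blast
    obtain u where u: "u \<in> span S" "\<And>w. w \<in> span S \<Longrightarrow> Q (v - u) w = 0" using insert.IH by blast
    define b' where "b' = b - c"
    \<comment> \<open>If b' is null, division by zero makes \<open>t\<close> equal to 0, and
      \<open>null\<close> gives the orthogonality.\<close>
    define t where "t = Q v b' / Q b' b'"
    have m: "span S \<subseteq> span (insert b S)" by (rule span_mono) auto
    have b': "b' \<in> span (insert b S)"
      unfolding b'_def using c(1) m by (intro span_diff) (auto intro: span_base)
    have ub: "Q u b' = 0" using c(2)[OF u(1)] Q(2) by (simp add: b'_def)
    have vb: "Q (v - (u + t *\<^sub>R b')) b' = 0"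
      using ub null[of b' v] by (cases "Q b' b' = 0") (auto simp: Qs t_def)
    show ?case
    proof (intro bexI ballI)
      show "u + t *\<^sub>R b' \<in> span (insert b S)" using u(1) m b' by (intro span_add span_scale) auto
      fix w assume "w \<in> span (insert b S)"
      then obtain k where k: "w - k *\<^sub>R b \<in> span S" using span_breakdown_eq by blast
      have "w - k *\<^sub>R b' = (w - k *\<^sub>R b) + k *\<^sub>R c" by (simp add: b'_def algebra_simps)
      hence w: "w - k *\<^sub>R b' \<in> span S" using k c(1) by (simp only: span_add span_scale)
      have "Q (v - (u + t *\<^sub>R b')) (w - k *\<^sub>R b') = Q (v - u) (w - k *\<^sub>R b') - t * Q b' (w - k *\<^sub>R b')"
        by (simp add: Qs algebra_simps)
      also have "\<dots> = 0" using u(2)[OF w] c(2)[OF w] by (simp add: b'_def)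
      finally show "Q (v - (u + t *\<^sub>R b')) w = 0" using vb by (simp add: Qs)
    qed
  qed
  moreover obtain B where "finite B" "span B = U"
    using basis_exists[of U] U by (metis finiteI_independent span_eq_iff span_minimal subset_antisym)
  ultimately show thesis using that by metis
qed

section \<open>Ideals not invariant under \<open>J\<close>\<close>

text \<open>
  The case \<open>J A \<noteq> A\<close>. The functionals \<open>al\<close> and \<open>be\<close> are the coefficients of \<open>p\<close> and \<open>q\<close> with respect to
  the decomposition of the whole space into \<open>U\<close> and the span of \<open>p, q, J p, J q\<close>; the coefficients of
  \<open>J p\<close> and \<open>J q\<close> at \<open>v\<close> are then \<open>- al (J v)\<close> and \<open>- be (J v)\<close>.
\<close>

locale noninvariant_ideal = hermitian_lie_algebra J g br
  for J :: "'a::euclidean_space \<Rightarrow> 'a" and g and br :: "'a \<Rightarrow> 'a \<Rightarrow> 'a" +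
  fixes A U :: "'a set" and p q :: 'a and al be :: "'a \<Rightarrow> real" and s :: real
  assumes cs: "complex_structure br J" and pl: "pluriclosed br J g" and uni: "unimodular br"
    and ideal: "lie_ideal br A" and abelian: "abelian_on br A"
    and U: "subspace U" "J ` U \<subseteq> U" "U \<subseteq> A" and U_I: "\<And>x. x \<in> A \<Longrightarrow> J x \<in> A \<Longrightarrow> x \<in> U"
    and pq: "p \<in> A" "q \<in> A"
    and lin: "linear al" "linear be" and al_U: "\<And>x. x \<in> U \<Longrightarrow> al x = 0" and be_U: "\<And>x. x \<in> U \<Longrightarrow> be x = 0"
    and al_val: "al p = 1" "al q = 0" "al (J p) = 0" "al (J q) = 0"
    and be_val: "be p = 0" "be q = 1" "be (J p) = 0" "be (J q) = 0"
    and rep: "\<And>v. v - (al v *\<^sub>R p + be v *\<^sub>R q - al (J v) *\<^sub>R J p - be (J v) *\<^sub>R J q) \<in> U"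
    and s: "s\<^sup>2 < 1" and frame_sum: "br p (J p) + br q (J q) = s *\<^sub>R br (J p) (J q)"
begin

abbreviation X :: "'a \<Rightarrow> 'a" where "X \<equiv> br (J p)"
abbreviation Y :: "'a \<Rightarrow> 'a" where "Y \<equiv> br (J q)"

lemmas lin_simps [simp] = linear_add[OF lin(1)] linear_add[OF lin(2)] linear_diff[OF lin(1)]
  linear_diff[OF lin(2)] linear_scale[OF lin(1)] linear_scale[OF lin(2)] linear_neg[OF lin(1)]
  linear_neg[OF lin(2)] linear_0[OF lin(1)] linear_0[OF lin(2)]

lemma A: "subspace A" "\<And>x a. a \<in> A \<Longrightarrow> br x a \<in> A" "\<And>a b. a \<in> A \<Longrightarrow> b \<in> A \<Longrightarrow> br a b = 0"
  using ideal abelian by (auto simp: lie_ideal_def abelian_on_def)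

lemma U_A: "u \<in> U \<Longrightarrow> u \<in> A" and U_J: "u \<in> U \<Longrightarrow> J u \<in> U"
  using U by auto

lemma integrable: "br x y - br (J x) (J y) + J (br (J x) y) + J (br x (J y)) = 0"
  using cs by (simp add: complex_structure_def)

lemma br_J_U:
  assumes "x \<in> A" "u \<in> U"
  shows "br (J x) (J u) = J (br (J x) u)" "br (J x) u \<in> U"
proof -
  show c: "br (J x) (J u) = J (br (J x) u)"
    using integrable[of x u] A(3)[OF assms(1) U_A[OF assms(2)]] A(3)[OF assms(1) U_A[OF U_J[OF assms(2)]]]
    by simp
  show "br (J x) u \<in> U"
  proof (rule U_I)
    show "br (J x) u \<in> A" by (rule A(2)) (rule U_A[OF assms(2)])
    show "J (br (J x) u) \<in> A" unfolding c[symmetric] by (rule A(2)) (rule U_A[OF U_J[OF assms(2)]])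
  qed
qed

lemmas X_U = br_J_U[OF pq(1)] and Y_U = br_J_U[OF pq(2)]

lemma br_Jp_Jq: "br (J p) (J q) = J (X q - Y p)"
  using integrable[of p q] A(3)[OF pq] br_skew[of p "J q"] by (simp add: algebra_simps)

text \<open>A component of \<open>x\<close> along \<open>J p\<close> and \<open>J q\<close> would be
  -\<open>J y\<close> with \<open>y\<close> in the span of \<open>p\<close> and \<open>q\<close>.
  Then both \<open>y\<close> and \<open>J y\<close> lie in \<open>A\<close>, so \<open>y\<close>
  lies in \<open>U\<close>, where \<open>al\<close> and \<open>be\<close> vanish.\<close>

lemma J_coeff_A:
  assumes "x \<in> A" shows "al (J x) = 0" "be (J x) = 0" "x - (al x *\<^sub>R p + be x *\<^sub>R q) \<in> U"
proof -
  define y where "y = al (J x) *\<^sub>R p + be (J x) *\<^sub>R q"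
  define u where "u = x - (al x *\<^sub>R p + be x *\<^sub>R q - al (J x) *\<^sub>R J p - be (J x) *\<^sub>R J q)"
  have u: "u \<in> U" unfolding u_def by (rule rep)
  have y: "y \<in> A" unfolding y_def using pq by (intro subspace_add subspace_scale A(1))
  have "J y = u - x + (al x *\<^sub>R p + be x *\<^sub>R q)" by (simp add: u_def y_def algebra_simps)
  moreover have "\<dots> \<in> A" using assms pq U_A[OF u]
    by (intro subspace_add subspace_scale subspace_diff A(1))
  ultimately have "y \<in> U" using U_I[OF y] by simp
  hence "al y = 0" "be y = 0" using al_U be_U by auto
  thus z: "al (J x) = 0" "be (J x) = 0" by (auto simp: y_def al_val be_val)
  show "x - (al x *\<^sub>R p + be x *\<^sub>R q) \<in> U" using u by (simp add: u_def z)
qed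

text \<open>The balanced relation expresses \<open>X p + Y q\<close> as \<open>J\<close> of an
  element of \<open>A\<close>; since it also lies in \<open>A\<close>, it lies in
  \<open>U\<close>.\<close>

lemma sum_in_U: "X p + Y q = - s *\<^sub>R J (X q - Y p)" "X p + Y q \<in> U"
proof -
  show e: "X p + Y q = - s *\<^sub>R J (X q - Y p)"
    using frame_sum br_skew[of p "J p"] br_skew[of q "J q"] unfolding br_Jp_Jq
    by (simp add: algebra_simps eq_neg_iff_add_eq_0)
  have a: "X p + Y q \<in> A" "X q - Y p \<in> A"
    using pq by (auto intro!: subspace_add subspace_diff A(1,2))
  have "J (X p + Y q) = s *\<^sub>R (X q - Y p)" unfolding e by (simp add: algebra_simps)
  hence "J (X p + Y q) \<in> A" using a(2) subspace_scale[OF A(1)] by simp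
  thus "X p + Y q \<in> U" using U_I a by blast
qed

lemma skew_defect_U:
  assumes ab: "a \<in> U" "b \<in> U" shows "skew_defect X a b = 0" "skew_defect Y a b = 0"
proof -
  have eq: "skew_defect X (J (X a)) a + skew_defect X (J (X (J a))) (J a)
      + skew_defect Y (J (Y a)) a + skew_defect Y (J (Y (J a))) (J a) = 0" if "a \<in> U" for a
  proof -
    note aA = U_A[OF that] U_A[OF U_J[OF that]]
    have J0: "J 0 \<in> A" using A(1) by (simp add: subspace_0)
    have 1: "dw (J (br x (J x))) (J a) a
      + (skew_defect (br (J x)) (J (br (J x) a)) a + skew_defect (br (J x)) (J (br (J x) (J a))) (J a)) = 0"
      if x: "x \<in> A" for x
    proof -
      have z: "br x a = 0" "br x (J a) = 0" using A(3) x aA by auto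
      have J: "J (br (J x) a) \<in> A" "J (br (J x) (J a)) \<in> A"
        by (rule U_A[OF U_J[OF br_J_U(2)[OF x \<open>a \<in> U\<close>]]],
            rule U_A[OF U_J[OF br_J_U(2)[OF x U_J[OF \<open>a \<in> U\<close>]]]])
      show ?thesis using pluriclosed_ideal[OF cs pl abelian aA, of x] J0 J unfolding z
        by (simp add: skew_defect_def w_bilinear_simps z)
    qed
    \<comment> \<open>In the sum of the relations for \<open>p\<close> and \<open>q\<close>, the
      balanced condition merges the leading terms into d\<omega> on three vectors of
      \<open>A\<close>, which is zero.\<close>
    have "X q - Y p \<in> A" using pq by (auto intro!: subspace_diff A(1,2))
    hence "dw (X q - Y p) (J a) a = 0" using aA by (intro dw_abelian[OF abelian])
    moreover have "J (br p (J p) + br q (J q)) = - s *\<^sub>R (X q - Y p)"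
      unfolding frame_sum br_Jp_Jq by (simp add: algebra_simps)
    ultimately have "dw (J (br p (J p) + br q (J q))) (J a) a = 0" by (simp only: dw_simps mult_zero_right)
    hence "dw (J (br p (J p))) (J a) a + dw (J (br q (J q))) (J a) a = 0" by (simp add: dw_simps)
    thus ?thesis using 1[OF pq(1)] 1[OF pq(2)] by linarith
  qed
  show "skew_defect X a b = 0" "skew_defect Y a b = 0"
    using skew_defect_vanish[OF U(1,2) linear_br _ linear_br _ eq ab] X_U(2) Y_U(2) by blast+
qed

text \<open>The trace is taken in a basis of \<open>U\<close> completed by
  \<open>p, q, J p, J q\<close>; the part on \<open>U\<close> cancels by the last
  hypothesis.\<close>

lemma trace_formula:
  assumes f: "linear f" "\<And>u. u \<in> U \<Longrightarrow> f u \<in> U" "\<And>u. u \<in> U \<Longrightarrow> g (f u) u + g (f (J u)) (J u) = 0"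
  shows "linear_trace f = al (f p) + be (f q) - al (J (f (J p))) - be (J (f (J q)))"
proof -
  obtain es where es: "subframe U es" using exists_subframe[OF U(1,2)] by blast
  \<comment> \<open>The complement of \<open>U\<close> need not be \<open>g\<close>-orthogonal, so
    coordinates on \<open>U\<close> are read after projecting along it.\<close>
  define P where "P v = v - (al v *\<^sub>R p + be v *\<^sub>R q - al (J v) *\<^sub>R J p - be (J v) *\<^sub>R J q)" for v
  have linP: "linear P" by (simp add: linear_iff P_def algebra_simps)
  have PU: "P u = u" if "u \<in> U" for u using that al_U be_U U_J by (simp add: P_def)
  define ixs where "ixs = map (\<lambda>u. (\<lambda>v. g (P v) u, u)) (pairs J es)
    @ [(al, p), (be, q), (\<lambda>v. - al (J v), J p), (\<lambda>v. - be (J v), J q)]"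
  have "linear_trace f = (\<Sum>i\<leftarrow>ixs. fst i (f (snd i)))"
  proof (rule linear_trace_dual_basis_list[OF f(1), where \<phi> = fst and b = snd])
    fix x
    have Px: "P x = (\<Sum>u\<leftarrow>pairs J es. g (P x) u *\<^sub>R u)"
      by (rule subframeD(3)[OF es]) (unfold P_def, rule rep)
    have "(\<Sum>i\<leftarrow>ixs. fst i x *\<^sub>R snd i) = (\<Sum>u\<leftarrow>pairs J es. g (P x) u *\<^sub>R u)
      + (al x *\<^sub>R p + be x *\<^sub>R q - al (J x) *\<^sub>R J p - be (J x) *\<^sub>R J q)"
      by (simp add: ixs_def o_def)
    also have "\<dots> = x" unfolding Px[symmetric] by (simp add: P_def)
    finally show "x = (\<Sum>i\<leftarrow>ixs. fst i x *\<^sub>R snd i)" by (rule sym)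
  qed (use lin in \<open>auto simp: ixs_def linear_iff linear_add[OF linP] linear_scale[OF linP]\<close>)
  also have "\<dots> = (\<Sum>u\<leftarrow>pairs J es. g (P (f u)) u) + al (f p) + be (f q) - al (J (f (J p))) - be (J (f (J q)))"
    by (simp add: ixs_def o_def)
  also have "(\<Sum>u\<leftarrow>pairs J es. g (P (f u)) u) = (\<Sum>e\<leftarrow>es. 0)"
    unfolding sum_list_pairs using subframeD(2)[OF es] f(2,3) U_J
    by (intro arg_cong[where f = sum_list] map_cong) (auto simp: PU subset_iff)
  finally show ?thesis by simp
qed

lemma g_skew_U:
  assumes "x \<in> A" "\<And>a b. a \<in> U \<Longrightarrow> b \<in> U \<Longrightarrow> skew_defect (br (J x)) a b = 0" "a \<in> U" "b \<in> U"
  shows "g (br (J x) a) b = - g a (br (J x) b)"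
  using assms(2)[OF assms(3) U_J[OF assms(4)]] br_J_U(1)[OF assms(1,4)]
  by (simp add: skew_defect_def)

lemma g_X: "a \<in> U \<Longrightarrow> b \<in> U \<Longrightarrow> g (X a) b = - g a (X b)"
  and g_Y: "a \<in> U \<Longrightarrow> b \<in> U \<Longrightarrow> g (Y a) b = - g a (Y b)"
  using g_skew_U[OF pq(1) skew_defect_U(1)] g_skew_U[OF pq(2) skew_defect_U(2)] by blast+

text \<open>These say that \<open>X\<close> and \<open>Y\<close> have trace zero. On
  \<open>U\<close> they are \<open>g\<close>-skew and contribute nothing; the terms at
  \<open>J p\<close> and \<open>J q\<close> come from \<open>br_Jp_Jq\<close>.\<close>

lemma trace_relations:
  "be (Y p) = al (X p) + 2 * be (X q)" "2 * al (Y p) = al (X q) + be (X p)"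
proof -
  have t: "linear_trace (br x) = 0" for x using uni by (simp add: unimodular_def)
  have YU: "Y (J p) = - J (X q - Y p)" using br_skew[of "J q" "J p"] by (simp add: br_Jp_Jq)
  have S: "al (Y q) = - al (X p)" "be (Y q) = - be (X p)"
    using al_U[OF sum_in_U(2)] be_U[OF sum_in_U(2)] by auto
  have gX: "g (X u) u + g (X (J u)) (J u) = 0" if "u \<in> U" for u
    using g_X[OF that that] X_U[OF that] g_sym[of u "X u"] by simp
  have gY: "g (Y u) u + g (Y (J u)) (J u) = 0" if "u \<in> U" for u
    using g_Y[OF that that] Y_U[OF that] g_sym[of u "Y u"] by simp
  show "be (Y p) = al (X p) + 2 * be (X q)"
    using trace_formula[OF linear_br X_U(2) gX] t br_Jp_Jq by simp
  show "2 * al (Y p) = al (X q) + be (X p)"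
    using trace_formula[OF linear_br Y_U(2) gY] t YU S by simp
qed

lemma coeff_br_A:
  assumes "x \<in> A" "v \<in> A"
  shows "al (br (J x) v) = al v * al (br (J x) p) + be v * al (br (J x) q)"
    "be (br (J x) v) = al v * be (br (J x) p) + be v * be (br (J x) q)"
proof -
  have "br (J x) (v - (al v *\<^sub>R p + be v *\<^sub>R q)) \<in> U"
    by (rule br_J_U(2)[OF assms(1)]) (rule J_coeff_A(3)[OF assms(2)])
  from al_U[OF this] be_U[OF this] show
    "al (br (J x) v) = al v * al (br (J x) p) + be v * al (br (J x) q)"
    "be (br (J x) v) = al v * be (br (J x) p) + be v * be (br (J x) q)" by auto
qed

text \<open>By Jacobi the commutator is ad of \<open>br (J p) (J q)\<close>, which is
  \<open>J z\<close> for an element \<open>z\<close> of \<open>A\<close>. Modulo \<open>U\<close>,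
  \<open>z\<close> is a combination of \<open>p\<close> and \<open>q\<close>, and the image of
  \<open>U\<close> under \<open>J\<close> acts trivially on \<open>A\<close>.\<close>

lemma commutator_A:
  assumes "v \<in> A"
  shows "X (Y v) - Y (X v) = al (X q - Y p) *\<^sub>R X v + be (X q - Y p) *\<^sub>R Y v"
proof -
  define z where "z = X q - Y p"
  have zA: "z \<in> A" using pq by (auto simp: z_def intro!: subspace_diff A(1,2))
  define u where "u = z - (al z *\<^sub>R p + be z *\<^sub>R q)"
  have "u \<in> U" unfolding u_def by (rule J_coeff_A(3)[OF zA])
  hence "br (J u) v = 0" using A(3) U_A U_J assms by blast
  moreover have "J z = J u + (al z *\<^sub>R J p + be z *\<^sub>R J q)" by (simp add: u_def)
  ultimately have "br (J z) v = al z *\<^sub>R X v + be z *\<^sub>R Y v" by simp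
  moreover have "X (Y v) - Y (X v) = br (br (J p) (J q)) v"
    using jacobi[of "J p" "J q" v] br_skew[of v "J p"] br_skew[of v "br (J p) (J q)"]
    by (simp add: algebra_simps)
  ultimately show ?thesis by (simp add: br_Jp_Jq z_def)
qed

text \<open>Modulo \<open>U\<close>, \<open>X\<close> and \<open>Y\<close> act on \<open>A\<close>
  as 2x2 matrices. The balanced and trace relations leave four entries, for which the commutation
  relation at \<open>q\<close> and at \<open>p\<close> gives two quadratic equations.\<close>

lemma coefficients_zero:
  "al (X p) = 0" "al (X q) = 0" "be (X p) = 0" "be (X q) = 0" "al (Y p) = 0" "be (Y p) = 0"
proof -
  define a b c d where "a = al (X p)" and "b = al (X q)" and "c = be (X p)" and "d = be (X q)"
  note abcd = a_def[symmetric] b_def[symmetric] c_def[symmetric] d_def[symmetric]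
  have S: "al (Y q) = - a" "be (Y q) = - c"
    using al_U[OF sum_in_U(2)] be_U[OF sum_in_U(2)] by (auto simp: a_def c_def)
  have e: "al (Y p) = (b + c) / 2" and f: "be (Y p) = a + 2 * d"
    using trace_relations by (auto simp: abcd)
  have br_A: "X p \<in> A" "X q \<in> A" "Y p \<in> A" "Y q \<in> A" using pq A(2) by auto
  note cX = coeff_br_A[OF pq(1)] and cY = coeff_br_A[OF pq(2)]
  have "al (X (Y q) - Y (X q)) = al (X q - Y p) * al (X q) + be (X q - Y p) * al (Y q)"
    "be (X (Y p) - Y (X p)) = al (X q - Y p) * be (X p) + be (X q - Y p) * be (Y p)"
    unfolding commutator_A[OF pq(1)] commutator_A[OF pq(2)] by simp_all
  hence "- a * a - c * b - (b * ((b + c) / 2) - d * a) = (b - (b + c) / 2) * b - (d - (a + 2 * d)) * a"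
    and "(b + c) / 2 * c + (a + 2 * d) * d - (a * (a + 2 * d) - c * c) = (b - (b + c) / 2) * c + (d - (a + 2 * d)) * (a + 2 * d)"
    by (simp_all add: cX[OF br_A(4)] cX[OF br_A(3)] cY[OF br_A(1)] cY[OF br_A(2)] abcd S e f algebra_simps)
  hence "2 * a\<^sup>2 + b\<^sup>2 + b * c = 0" "c\<^sup>2 + a * d + 2 * d\<^sup>2 = 0"
    by (simp_all add: power2_eq_square field_simps)
  \<comment> \<open>twice the sum of the two equations is a positive definite quadratic form in \<open>a, b, c, d\<close>\<close>
  hence "3 * a\<^sup>2 + 3 * d\<^sup>2 + (a + d)\<^sup>2 + b\<^sup>2 + c\<^sup>2 + (b + c)\<^sup>2 = 0"
    by (simp add: power2_eq_square algebra_simps)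
  hence z: "a = 0" "b = 0" "c = 0" "d = 0"
    by (smt (verit) zero_le_power2 zero_less_power2)+
  show "al (X p) = 0" "al (X q) = 0" "be (X p) = 0" "be (X q) = 0" "al (Y p) = 0" "be (Y p) = 0"
    using z e f by (auto simp: abcd)
qed

lemma br_pq_U: "X p \<in> U" "X q \<in> U" "Y p \<in> U" "Y q \<in> U"
proof -
  have br_A: "X p \<in> A" "X q \<in> A" "Y p \<in> A" "Y q \<in> A" using pq A(2) by auto
  show "X p \<in> U" "X q \<in> U" "Y p \<in> U"
    using J_coeff_A(3)[OF br_A(1)] J_coeff_A(3)[OF br_A(2)] J_coeff_A(3)[OF br_A(3)]
    by (simp_all add: coefficients_zero)
  thus "Y q \<in> U" using subspace_diff[OF U(1) sum_in_U(2), of "X p"] by simp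
qed

lemma commute_A: "v \<in> A \<Longrightarrow> X (Y v) = Y (X v)"
  using commutator_A[of v] by (simp add: coefficients_zero)

text \<open>
  \<open>u\<close> minimizes \<open>g (X (v - u)) (X (v - u)) + g (Y (v - u)) (Y (v - u))\<close>. As \<open>X\<close> and \<open>Y\<close> are
  skew on \<open>U\<close>, this means \<open>X P + Y R = 0\<close> for \<open>P = X (v - u)\<close> and \<open>R = Y (v - u)\<close>, and commutativity
  gives \<open>X R = Y P\<close>.
\<close>

lemma kernel_shift:
  assumes v: "v \<in> A" "X v \<in> U" "Y v \<in> U"
  obtains u where "u \<in> U" "X (X (v - u)) = 0" "X (Y (v - u)) = 0" "Y (X (v - u)) = 0" "Y (Y (v - u)) = 0"
proof -
  define Q where "Q x y = g (X x) (X y) + g (Y x) (Y y)" for x y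
  have Q: "bilinear Q" by (simp add: bilinear_def linear_iff Q_def algebra_simps)
  have "Q x y = Q y x" "Q x x \<ge> 0" for x y by (auto simp: Q_def g_sym intro: add_nonneg_nonneg g_nonneg)
  then obtain u where u: "u \<in> U" "\<And>w. w \<in> U \<Longrightarrow> Q (v - u) w = 0"
    using exists_semidefinite_projection[OF Q _ _ U(1)] by metis
  define P R where "P = X (v - u)" and "R = Y (v - u)"
  have PU: "P \<in> U" "R \<in> U"
    using v(2,3) X_U(2)[OF u(1)] Y_U(2)[OF u(1)] U(1) by (auto simp: P_def R_def intro: subspace_diff)
  have vuA: "v - u \<in> A" using v(1) U_A[OF u(1)] by (rule subspace_diff[OF A(1)])
  have c: "X R = Y P" using commute_A[OF vuA] by (simp only: P_def R_def)
  define Z where "Z = X P + Y R"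
  have ZU: "Z \<in> U" unfolding Z_def using X_U(2)[OF PU(1)] Y_U(2)[OF PU(2)] by (rule subspace_add[OF U(1)])
  have "g Z w = 0" if "w \<in> U" for w
  proof -
    have "g P (X w) + g R (Y w) = 0" using u(2)[OF that] unfolding Q_def P_def R_def .
    thus ?thesis using g_X[OF PU(1) that] g_Y[OF PU(2) that] by (simp add: Z_def)
  qed
  hence "Z = 0" using ZU g_zero_iff by blast
  hence XP: "X P = - Y R" by (simp add: Z_def eq_neg_iff_add_eq_0)
  \<comment> \<open>Moving \<open>X\<close> and \<open>Y\<close> across \<open>g\<close> shows that
    the squared norm of \<open>X P\<close> is minus that of \<open>X R\<close>, so both
    vanish.\<close>
  have "g (X P) (X P) = - g (Y R) (X P)" by (subst XP) simp
  also have "\<dots> = g R (Y (X P))" using g_Y[OF PU(2) X_U(2)[OF PU(1)]] by simp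
  also have "Y (X P) = X (X R)" using commute_A[OF U_A[OF PU(1)]] c by simp
  also have "g R (X (X R)) = - g (X R) (X R)" using g_X[OF PU(2) X_U(2)[OF PU(2)]] by simp
  finally have "X P = 0" "X R = 0" using g_nonneg[of "X P"] g_nonneg[of "X R"] by auto
  thus thesis using that[OF u(1)] c XP by (simp only: P_def R_def) simp
qed

lemma exists_kaehler: "\<exists>g'. compatible_metric J g' \<and> kaehler br J g'"
proof -
  obtain u1 where u1: "u1 \<in> U" "X (X (p - u1)) = 0" "X (Y (p - u1)) = 0" "Y (X (p - u1)) = 0" "Y (Y (p - u1)) = 0"
    using kernel_shift[OF pq(1) br_pq_U(1,3)] .
  obtain u2 where u2: "u2 \<in> U" "X (X (q - u2)) = 0" "X (Y (q - u2)) = 0" "Y (X (q - u2)) = 0" "Y (Y (q - u2)) = 0"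
    using kernel_shift[OF pq(2) br_pq_U(2,4)] .
  define p' q' where "p' = p - u1" and "q' = q - u2"
  define P R T Q where "P = X p'" and "R = X q'" and "T = Y p'" and "Q = Y q'"
  have A': "p' \<in> A" "q' \<in> A" using pq U_A u1(1) u2(1) by (auto simp: p'_def q'_def intro: subspace_diff A(1))
  have ker: "X P = 0" "X T = 0" "Y P = 0" "Y T = 0" "X R = 0" "X Q = 0" "Y R = 0" "Y Q = 0"
    using u1 u2 by (simp_all only: P_def R_def T_def Q_def p'_def q'_def)
  have inU: "P \<in> U" "R \<in> U" "T \<in> U" "Q \<in> U"
    using br_pq_U X_U(2)[OF u1(1)] X_U(2)[OF u2(1)] Y_U(2)[OF u1(1)] Y_U(2)[OF u2(1)]
    by (auto simp: P_def R_def T_def Q_def p'_def q'_def intro: subspace_diff U(1))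
  \<comment> \<open>\<open>J u1\<close> and \<open>J u2\<close> lie in \<open>A\<close>, so the
    shift does not change the action on \<open>A\<close>.\<close>
  have br': "br (J p') v = X v" "br (J q') v = Y v" if "v \<in> A" for v
    using A(3)[OF U_A[OF U_J[OF u1(1)]] that] A(3)[OF U_A[OF U_J[OF u2(1)]] that]
    by (simp_all add: p'_def q'_def)
  have b1: "br p' (J p') = - P" "br p' (J q') = - T" "br q' (J p') = - R" "br q' (J q') = - Q"
    "br (J p') p' = P" "br (J q') p' = T" "br (J p') q' = R" "br (J q') q' = Q"
    using br'[OF A'(1)] br'[OF A'(2)] br_skew[of p' "J p'"] br_skew[of p' "J q'"]
      br_skew[of q' "J p'"] br_skew[of q' "J q'"] by (simp_all add: P_def R_def T_def Q_def)
  have b2: "br (J p') (J q') = J (R - T)"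
    using integrable[of p' q'] A(3)[OF A'] b1 by (simp add: algebra_simps)
  define Z where "Z = R - T"
  define N where "N = {n \<in> U. X n = 0 \<and> Y n = 0}"
  have N: "n \<in> N \<Longrightarrow> J n \<in> N" for n using X_U(1) Y_U(1) U_J by (auto simp: N_def)
  have PN: "P \<in> N" "R \<in> N" "T \<in> N" "Q \<in> N" "Z \<in> N"
    using inU ker U(1) by (auto simp: N_def Z_def intro: subspace_diff)
  \<comment> \<open>\<open>L + M = 0\<close> is the balanced relation split by the shift.
    \<open>L\<close> lies in the kernel \<open>N\<close>, and \<open>M\<close> comes from images of
    \<open>U\<close> under \<open>X\<close> and \<open>Y\<close>; skewness makes these orthogonal to
    \<open>N\<close>, so both vanish.\<close>
  define L where "L = P + Q + s *\<^sub>R J Z"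
  have LN: "L \<in> N"
    using N[OF PN(5)] PN U(1) by (auto simp: N_def L_def intro!: subspace_add subspace_scale)
  define M where "M = X u1 + Y u2 + s *\<^sub>R J (X u2 - Y u1)"
  have "L = - M"
    using sum_in_U(1) by (simp add: L_def M_def Z_def P_def R_def T_def Q_def p'_def q'_def algebra_simps)
  moreover have "g L M = 0"
  proof -
    have "g n (X u) = 0 \<and> g n (Y u) = 0" if "n \<in> N" "u \<in> U" for n u
      using that g_X[of n u] g_Y[of n u] by (simp add: N_def)
    note o = this[OF LN] this[OF N[OF LN]]
    have "g L (J v) = - g (J L) v" for v by (rule g_J_right)
    thus ?thesis using o u1(1) u2(1) by (simp add: M_def)
  qed
  ultimately have "g L L = 0" by simp
  hence "L = 0" unfolding g_zero_iff .
  hence Q: "Q = - P - s *\<^sub>R J Z" by (simp add: L_def eq_neg_iff_add_eq_0 algebra_simps)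
  \<comment> \<open>The brackets among p', q' and their images under \<open>J\<close> lie in
    \<open>N\<close>, which commutes with these four vectors; one term of d\<omega>
    survives.\<close>
  have dN: "dw n x y = - w (br x y) n" if n: "n \<in> N" "br n x = 0" "br n y = 0" for n x y
    using that by (simp add: dw_def w_bilinear_simps)
  have brN: "br n (J p') = 0" "br n (J q') = 0" "br n p' = 0" "br n q' = 0" if "n \<in> N" for n
    using that br'[of n] br_skew[of n "J p'"] br_skew[of n "J q'"] A(3)[OF _ A'(1)] A(3)[OF _ A'(2)] U_A
    by (auto simp: N_def)
  have brJN: "br (J n) (J p') = 0" "br (J n) (J q') = 0" "br (J n) p' = 0" "br (J n) q' = 0" if "n \<in> N" for n
    using brN[OF N[OF that]] .
  have d: "dw (J n) (J q') q' = - w Q (J n)" "dw (J n) (J p') p' = - w P (J n)"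
    "dw (J n) p' (J q') = w T (J n)" "dw (J n) (J p') q' = - w R (J n)"
    "dw n (J p') (J q') = - w (J Z) n" if "n \<in> N" for n
    using that by (simp_all add: dN N brN brJN b1 b2 Z_def w_bilinear_simps)
  have "- dw (J (br p' (J p'))) (J q') (J (J q')) + dw (J (br p' q')) (J (J p')) (J (J q'))
    - dw (J (br p' (J q'))) (J (J p')) (J q') - dw (J (br (J p') q')) (J p') (J (J q'))
    + dw (J (br (J p') (J q'))) (J p') (J q') - dw (J (br q' (J q'))) (J p') (J (J p')) = 0"
    by (rule pluriclosed_pairs[OF cs pl])
  moreover have "dw 0 p' q' = 0" by (simp add: dw_def w_bilinear_simps)
  ultimately have "2 * g P Q - g T T - g R R - g Z Z = 0"
    using A(3)[OF A'] PN d(1)[OF PN(1)] d(2)[OF PN(4)] d(3)[OF PN(3)] d(4)[OF PN(2)] d(5)[OF PN(5)]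
    by (simp add: b1 b2 Z_def[symmetric] dw_simps w_bilinear_simps g_sym[of Q P])
  \<comment> \<open>Completing the square with \<open>Q = - P - s *\<^sub>R J Z\<close>; the
    coefficient \<open>1 - s\<^sup>2\<close> of \<open>g Z Z\<close> is then positive.\<close>
  moreover have "2 * g P Q = - g P P - g (P + s *\<^sub>R J Z) (P + s *\<^sub>R J Z) + s\<^sup>2 * g Z Z"
    unfolding Q using g_sym[of "J Z" P] by (simp add: power2_eq_square algebra_simps)
  ultimately have "g P P + g (P + s *\<^sub>R J Z) (P + s *\<^sub>R J Z) + (1 - s\<^sup>2) * g Z Z + g T T + g R R = 0"
    by (simp add: algebra_simps)
  moreover have "(1 - s\<^sup>2) * g Z Z \<ge> 0" using s g_nonneg by simp
  ultimately have "g P P = 0" "g T T = 0" "g R R = 0"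
    using g_nonneg[of P] g_nonneg[of T] g_nonneg[of R] g_nonneg[of "P + s *\<^sub>R J Z"] by linarith+
  hence z: "P = 0" "T = 0" "R = 0" "Q = 0" using Q by (auto simp: Z_def)
  \<comment> \<open>\<open>al\<close> and \<open>be\<close> vanish on \<open>U\<close>, so they are
    also the coefficients for p' and q'. \<open>Pr\<close> projects onto \<open>U\<close> along the
    commuting span of p', q', J p', J q'.\<close>
  define F where "F v = al v *\<^sub>R p' + be v *\<^sub>R q' - al (J v) *\<^sub>R J p' - be (J v) *\<^sub>R J q'" for v
  define Pr where "Pr v = v - F v" for v
  have PrU: "Pr v \<in> U" for v
  proof -
    have "Pr v = (v - (al v *\<^sub>R p + be v *\<^sub>R q - al (J v) *\<^sub>R J p - be (J v) *\<^sub>R J q))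
      + (al v *\<^sub>R u1 + be v *\<^sub>R u2 - al (J v) *\<^sub>R J u1 - be (J v) *\<^sub>R J u2)"
      by (simp add: Pr_def F_def p'_def q'_def algebra_simps)
    thus ?thesis using rep[of v] u1(1) u2(1) U_J
      by (auto intro!: subspace_add subspace_diff subspace_scale U(1))
  qed
  have Pr_id: "Pr u = u" if "u \<in> U" for u
    using that al_U be_U U_J by (simp add: Pr_def F_def)
  have vF: "v - Pr v = F v" for v by (simp add: Pr_def)
  show ?thesis
  proof (rule kaehler_if_split[where P = Pr])
    show "linear Pr" by (simp add: linear_iff Pr_def F_def algebra_simps)
    show "Pr (J x) = J (Pr x)" for x by (simp add: Pr_def F_def algebra_simps)
    show "Pr (Pr x) = Pr x" for x by (rule Pr_id) (rule PrU)
    show "br (Pr x) (Pr y) = 0" for x y by (rule A(3)) (rule U_A[OF PrU])+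
    show "br (x - Pr x) (y - Pr y) = 0" for x y
    proof -
      have "br q' p' = 0" "br p' q' = 0" "br (J q') (J p') = 0" "br (J p') (J q') = 0"
        using A(3) A' b2 z br_skew[of "J q'" "J p'"] by auto
      thus ?thesis unfolding vF F_def by (simp add: b1 z)
    qed
    have brF: "br (F x) u = - al (J x) *\<^sub>R X u - be (J x) *\<^sub>R Y u" if "u \<in> U" for x u
      using br'[OF U_A[OF that]] A(3)[OF A'(1) U_A[OF that]] A(3)[OF A'(2) U_A[OF that]]
      by (simp add: F_def)
    show "Pr (br x (Pr y)) = br x (Pr y)" for x y
    proof (rule Pr_id)
      have "br x (Pr y) = br (Pr x) (Pr y) + br (F x) (Pr y)"
        unfolding vF[symmetric] by (simp add: algebra_simps)
      also have "\<dots> = - al (J x) *\<^sub>R X (Pr y) - be (J x) *\<^sub>R Y (Pr y)"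
        using A(3)[OF U_A[OF PrU[of x]] U_A[OF PrU[of y]]] brF[OF PrU] by simp
      also have "\<dots> \<in> U" using X_U(2)[OF PrU] Y_U(2)[OF PrU]
        by (intro subspace_diff subspace_scale U(1))
      finally show "br x (Pr y) \<in> U" .
    qed
    show "skew_defect (br (x - Pr x)) (Pr a) (Pr b) = 0" for x a b
    proof -
      have "w (X (Pr a)) (Pr b) = - w (Pr a) (X (Pr b))" "w (Y (Pr a)) (Pr b) = - w (Pr a) (Y (Pr b))"
        using skew_defect_U[OF PrU[of a] PrU[of b]] by (simp_all add: skew_defect_def)
      thus ?thesis unfolding vF by (simp add: skew_defect_def brF[OF PrU] w_bilinear_simps)
    qed
  qed
qed

end

section \<open>A basis adapted to an ideal of codimension two\<close>

context hermitian
begin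

lemma dim_perp:
  assumes "subspace U" "J ` U \<subseteq> U"
  shows "dim U + dim (perp U) = DIM('a)" "even (dim U)"
proof -
  obtain es where es: "subframe U es" "dim U = 2 * length es" using exists_subframe[OF assms] by blast
  obtain fs where fs: "subframe (perp U) fs" "dim (perp U) = 2 * length fs"
    using exists_subframe[OF subspace_perp J_perp[OF assms(2)]] by blast
  show "dim U + dim (perp U) = DIM('a)"
    using DIM_frame[OF frame_append_perp[OF es(1) assms(2) fs(1)]] es(2) fs(2) by simp
  show "even (dim U)" using es by simp
qed

lemma inj_J: "inj J"
  by (rule injI) (metis J_J minus_minus)

lemma noninvariant_basis:
  assumes A: "subspace A" "dim A + 2 = DIM('a)" "\<not> J ` A \<subseteq> A"
  defines "U \<equiv> {a \<in> A. J a \<in> A}"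
  obtains p q where "p \<in> A" "q \<in> A" "p \<in> perp U" "q \<in> perp U" "g p p = 1" "g q q = 1" "g p q = 0"
    "\<And>v. v \<in> perp U \<Longrightarrow> \<exists>a b c d. v = a *\<^sub>R p + b *\<^sub>R q + c *\<^sub>R J p + d *\<^sub>R J q"
proof -
  have U: "subspace U" using A(1) by (auto simp: U_def subspace_def)
  have JU: "J ` U \<subseteq> U" using A(1) by (auto simp: U_def subspace_neg)
  define B where "B = A \<inter> perp U"
  have B: "subspace B" unfolding B_def by (intro subspace_inter A(1) subspace_perp)
  have JB: "subspace (J ` B)" by (rule linear_subspace_image[OF linear_J B])
  have dJB: "dim (J ` B) = dim B" by (rule dim_image_eq[OF linear_J]) (use inj_J in \<open>auto simp: inj_on_def\<close>)
  have UP: "x = 0" if "x \<in> U" "x \<in> perp U" for x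
  proof -
    have "g x x = 0" using that by (simp add: perp_def)
    thus ?thesis by simp
  qed
  have "A = {x + y |x y. x \<in> U \<and> y \<in> B}"
  proof
    obtain es where es: "subframe U es" using exists_subframe[OF U JU] by blast
    show "A \<subseteq> {x + y |x y. x \<in> U \<and> y \<in> B}"
    proof
      fix a assume a: "a \<in> A"
      obtain u where u: "u \<in> U" "a - u \<in> perp U" using projection_perp[OF es U JU] .
      have "a - u \<in> A" using a u(1) by (auto simp: U_def intro: subspace_diff[OF A(1)])
      hence "a - u \<in> B" using u(2) by (simp add: B_def)
      moreover have "a = u + (a - u)" by simp
      ultimately show "a \<in> {x + y |x y. x \<in> U \<and> y \<in> B}" using u(1) by blast
    qed
    show "{x + y |x y. x \<in> U \<and> y \<in> B} \<subseteq> A" by (auto simp: U_def B_def intro: subspace_add[OF A(1)])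
  qed
  moreover have "U \<inter> B = {0}" using UP subspace_0[OF U] subspace_0[OF B] by (auto simp: B_def)
  ultimately have dA: "dim A = dim U + dim B" using dim_sums_Int[OF U B] by simp
  define W where "W = {x + y |x y. x \<in> B \<and> y \<in> J ` B}"
  have W: "subspace W" unfolding W_def by (rule subspace_sums[OF B JB])
  have "B \<inter> J ` B = {0}"
  proof -
    have "x = 0" if x: "x \<in> B" "x \<in> J ` B" for x
    proof -
      obtain y where y: "x = J y" "y \<in> B" using x(2) by blast
      have "J x \<in> A" using y A(1) by (auto simp: B_def subspace_neg)
      hence "x \<in> U" using x(1) by (simp add: U_def B_def)
      thus ?thesis using UP x(1) by (simp add: B_def)
    qed
    thus ?thesis using subspace_0[OF B] subspace_0[OF JB] by auto
  qed
  hence dW: "dim W = 2 * dim B" using dim_sums_Int[OF B JB] dJB by (simp add: W_def)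
  have WP: "W \<subseteq> perp U"
    unfolding W_def using J_perp[OF JU] by (auto simp: B_def intro!: subspace_add[OF subspace_perp])
  hence "dim W \<le> dim (perp U)" by (rule dim_subset)
  moreover have "even (dim (perp U))" by (rule dim_perp(2)[OF subspace_perp J_perp[OF JU]])
  moreover have "B \<noteq> {0}"
  proof
    assume "B = {0}"
    hence "A = U" using \<open>A = {x + y |x y. x \<in> U \<and> y \<in> B}\<close> by auto
    thus False using A(3) JU by simp
  qed
  hence "dim B > 0" using B by (metis dim_eq_0 bot_nat_0.not_eq_extremum subset_singleton_iff
        subspace_0 empty_iff)
  moreover have PB: "dim (perp U) = dim B + 2" using dim_perp(1)[OF U JU] dA A(2) by linarith
  ultimately have "dim B \<le> 2" "even (dim B)" "dim B > 0" using dW by auto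
  hence d2: "dim B = 2" by (auto dest: dvd_imp_le)
  hence d4: "dim (perp U) = 4" using PB by simp
  have "span W = span (perp U)" by (rule dim_eq_span[OF WP]) (simp add: dW d2 d4)
  hence WP': "W = perp U" using W subspace_perp by (metis span_eq_iff)
  obtain p where p: "p \<in> B" "g p p = 1" using exists_unit[OF B \<open>B \<noteq> {0}\<close>] .
  define C where "C = {b \<in> B. g b p = 0}"
  have C: "subspace C" using B by (auto simp: C_def subspace_def)
  have dec: "b - g b p *\<^sub>R p \<in> C" if "b \<in> B" for b
    using that p by (auto simp: C_def intro: subspace_diff[OF B] subspace_scale[OF B])
  have "C \<noteq> {0}"
  proof
    assume "C = {0}"
    hence "b = g b p *\<^sub>R p" if "b \<in> B" for b using dec[OF that] by simp
    hence "B \<subseteq> span {p}" by (metis span_base span_scale singletonI subsetI)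
    hence "dim B \<le> card {p}" by (rule dim_le_card) simp
    thus False using d2 by simp
  qed
  then obtain q where q: "q \<in> C" "g q q = 1" using exists_unit[OF C] by blast
  have "p \<notin> span {q}"
  proof
    assume "p \<in> span {q}"
    then obtain k where "p = k *\<^sub>R q" by (auto simp: span_singleton)
    hence "g p p = k * g q p" by simp
    thus False using p(2) q(1) by (simp add: C_def)
  qed
  moreover have "q \<noteq> 0" using q(2) by auto
  ultimately have "dim {p, q} = 2" by (simp add: dim_insert)
  moreover have "{p, q} \<subseteq> B" using p q by (auto simp: C_def)
  ultimately have "span {p, q} = span B" using d2 by (intro dim_eq_span) auto
  hence Bpq: "\<exists>a c. b = a *\<^sub>R p + c *\<^sub>R q" if "b \<in> B" for b
  proof -
    have "b \<in> span {p, q}" using that \<open>span {p, q} = span B\<close> by (simp add: span_base)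
    then obtain a c where "b - a *\<^sub>R p = c *\<^sub>R q"
      by (auto simp: span_breakdown_eq[of b p "{q}"] span_singleton)
    hence "b = a *\<^sub>R p + c *\<^sub>R q" by (simp add: algebra_simps)
    thus ?thesis by blast
  qed
  show thesis
  proof (rule that[of p q])
    fix v assume "v \<in> perp U"
    then obtain b b' where v: "v = b + J b'" "b \<in> B" "b' \<in> B" unfolding WP'[symmetric] W_def by auto
    then obtain a1 a2 a3 a4 where "b = a1 *\<^sub>R p + a2 *\<^sub>R q" "b' = a3 *\<^sub>R p + a4 *\<^sub>R q" using Bpq by blast
    hence "v = a1 *\<^sub>R p + a2 *\<^sub>R q + a3 *\<^sub>R J p + a4 *\<^sub>R J q" using v by (simp add: algebra_simps)
    thus "\<exists>a b c d. v = a *\<^sub>R p + b *\<^sub>R q + c *\<^sub>R J p + d *\<^sub>R J q" by blast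
  qed (use p q g_sym[of p q] in \<open>auto simp: B_def C_def\<close>)
qed

end

section \<open>Frames for the balanced metric, forms for the pluriclosed metric\<close>

locale metric_pair = G: hermitian_lie_algebra J g br + H: hermitian_lie_algebra J h br
  for J :: "'a::euclidean_space \<Rightarrow> 'a" and g h and br :: "'a \<Rightarrow> 'a \<Rightarrow> 'a" +
  fixes A :: "'a set"
  assumes cs: "complex_structure br J" and pl: "pluriclosed br J g" and uni: "unimodular br"
    and bal: "balanced br J h"
    and ideal: "lie_ideal br A" and abelian: "abelian_on br A" and dimA: "dim A + 2 = DIM('a)"
begin

lemma A: "subspace A" "\<And>x a. a \<in> A \<Longrightarrow> br x a \<in> A" "\<And>a b. a \<in> A \<Longrightarrow> b \<in> A \<Longrightarrow> br a b = 0"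
  using ideal abelian by (auto simp: lie_ideal_def abelian_on_def)

lemma frame_sum_ideal:
  assumes "set es \<subseteq> A" "J ` set es \<subseteq> A" "H.frame (es @ fs)"
  shows "(\<Sum>f\<leftarrow>fs. br f (J f)) = 0"
proof -
  have "(\<Sum>e\<leftarrow>es. br e (J e)) = (\<Sum>e\<leftarrow>es. 0)"
    using assms(1,2) A(3) by (intro arg_cong[where f = sum_list] map_cong) auto
  thus ?thesis using H.balanced_frame_sum[OF bal uni assms(3)] by simp
qed

lemma exists_kaehler_invariant:
  assumes JA: "J ` A \<subseteq> A"
  shows "\<exists>g'. compatible_metric J g' \<and> kaehler br J g'"
proof -
  obtain es where es: "H.subframe A es" "dim A = 2 * length es" using H.exists_subframe[OF A(1) JA] by blast
  obtain fs where fs: "H.subframe (H.perp A) fs" "dim (H.perp A) = 2 * length fs"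
    using H.exists_subframe[OF H.subspace_perp H.J_perp[OF JA]] by blast
  have F: "H.frame (es @ fs)" by (rule H.frame_append_perp[OF es(1) JA fs(1)])
  \<comment> \<open>Codimension two leaves one complex direction, so the balanced sum reduces to the
    single bracket \<open>br x (J x)\<close>.\<close>
  have "length fs = 1" using H.DIM_frame[OF F] es(2) dimA by simp
  then obtain x where x: "fs = [x]" by (metis One_nat_def length_0_conv length_Suc_conv)
  have esA: "set es \<subseteq> A" by (rule H.subframeD(2)[OF es(1)])
  have xx: "br x (J x) = 0" "br (J x) x = 0"
    using frame_sum_ideal[OF esA _ F] esA JA G.br_skew[of "J x" x] by (auto simp: x)
  have z: "skew_defect (br x) a b = 0 \<and> skew_defect (br (J x)) a b = 0"
    if "skew_defect = G.skew_defect" "a \<in> A" "b \<in> A" for skew_defect a b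
    unfolding that(1)
  proof (rule conjI)
    have e: "G.skew_defect (br x) (J (br x a)) a + G.skew_defect (br x) (J (br x (J a))) (J a)
      + G.skew_defect (br (J x)) (J (br (J x) a)) a + G.skew_defect (br (J x)) (J (br (J x) (J a))) (J a) = 0"
      if "a \<in> A" for a
    proof -
      have J: "c \<in> A \<Longrightarrow> J c \<in> A" for c using JA by auto
      have "J a \<in> A" using J that .
      thus ?thesis
        using G.pluriclosed_ideal[OF cs pl abelian that, of x] that J A(2) xx
        by (simp add: G.dw_def G.w_bilinear_simps)
    qed
    note v = G.skew_defect_vanish[OF A(1) JA G.linear_br _ G.linear_br _ e that(2,3)]
    show "G.skew_defect (br x) a b = 0" by (rule v(1)) (use A(2) in auto)
    show "G.skew_defect (br (J x)) a b = 0" by (rule v(2)) (use A(2) in auto)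
  qed
  note skew = z[OF refl]
  have hx: "h a x = 0" "h a (J x) = 0" if "a \<in> A" for a
  proof -
    have "x \<in> H.perp A" "J x \<in> H.perp A"
      using H.subframeD(2)[OF fs(1)] H.J_perp[OF JA] by (auto simp: x)
    thus "h a x = 0" "h a (J x) = 0" using that H.g_sym[of a] by (auto simp: H.perp_def)
  qed
  \<comment> \<open>The projection onto \<open>A\<close> is orthogonal for \<open>h\<close>, while
    the new metric is assembled from \<open>g\<close>.\<close>
  define P where "P v = v - (h v x *\<^sub>R x + h v (J x) *\<^sub>R J x)" for v
  have PA: "P v \<in> A" for v
  proof -
    have "v = (\<Sum>u\<leftarrow>pairs J (es @ fs). h v u *\<^sub>R u)" by (rule H.frameD(2)[OF F])
    hence "P v = (\<Sum>u\<leftarrow>pairs J es. h v u *\<^sub>R u)"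
      by (simp add: P_def x H.pairs_append algebra_simps)
    moreover have "set us \<subseteq> A \<Longrightarrow> (\<Sum>u\<leftarrow>us. h v u *\<^sub>R u) \<in> A" for us
      by (induction us) (auto intro: subspace_0 subspace_add subspace_scale A(1))
    ultimately show ?thesis using H.set_pairs_subset[OF esA JA] by simp
  qed
  have Pid: "P a = a" if "a \<in> A" for a using hx[OF that] by (simp add: P_def)
  have vP: "v - P v = h v x *\<^sub>R x + h v (J x) *\<^sub>R J x" for v by (simp add: P_def)
  show ?thesis
  proof (rule G.kaehler_if_split[where P = P])
    show "linear P" by (simp add: linear_iff P_def algebra_simps)
    show "P (J v) = J (P v)" for v by (simp add: P_def H.g_J_right)
    show "P (P v) = P v" for v by (rule Pid) (rule PA)
    show "br (P u) (P v) = 0" for u v by (rule A(3)[OF PA PA])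
    show "br (u - P u) (v - P v) = 0" for u v unfolding vP by (simp add: xx)
    show "P (br u (P v)) = br u (P v)" for u v by (rule Pid) (rule A(2)[OF PA])
    show "G.skew_defect (br (v - P v)) (P a) (P b) = 0" for v a b
      unfolding vP by (simp add: G.skew_defect_br_simps skew[OF PA PA])
  qed
qed

lemma exists_kaehler_noninvariant:
  assumes JA: "\<not> J ` A \<subseteq> A"
  shows "\<exists>g'. compatible_metric J g' \<and> kaehler br J g'"
proof -
  define U where "U = {a \<in> A. J a \<in> A}"
  have U: "subspace U" using A(1) by (auto simp: U_def subspace_def)
  have JU: "J ` U \<subseteq> U" using A(1) by (auto simp: U_def subspace_neg)
  obtain p q where pq: "p \<in> A" "q \<in> A" "p \<in> H.perp U" "q \<in> H.perp U" "h p p = 1" "h q q = 1" "h p q = 0"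
    and span: "\<And>v. v \<in> H.perp U \<Longrightarrow> \<exists>a b c d. v = a *\<^sub>R p + b *\<^sub>R q + c *\<^sub>R J p + d *\<^sub>R J q"
    using H.noninvariant_basis[OF A(1) dimA JA] unfolding U_def[symmetric] by blast
  define s where "s = h (J p) q"
  have hv: "h q p = 0" "h q (J p) = s" "h p (J q) = - s" "h (J q) p = - s" "h (J p) q = s"
    using H.g_sym[of q p] H.g_sym[of q "J p"] H.g_sym[of "J q" p] H.g_J_right[of p q] pq(7)
    by (simp_all add: s_def)
  \<comment> \<open>\<open>p\<close> and \<open>q\<close> are orthonormal but need not be unitary:
    \<open>s\<close> measures the overlap of \<open>q\<close> with \<open>J p\<close>, which
    \<open>r\<close> removes. Since \<open>J q\<close> is not in \<open>A\<close>, \<open>r\<close>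
    is nonzero, which gives \<open>s\<^sup>2 < 1\<close>.\<close>
  define r where "r = q - s *\<^sub>R J p"
  have "h r r = 1 - s\<^sup>2" by (simp add: r_def hv pq power2_eq_square algebra_simps)
  moreover have "r \<noteq> 0"
  proof
    assume "r = 0"
    hence "J q = - s *\<^sub>R p" by (simp add: r_def)
    hence "J q \<in> A" using pq(1) subspace_scale[OF A(1)] subspace_neg[OF A(1)] by simp
    hence "q \<in> U" using pq(2) by (simp add: U_def)
    hence "h q q = 0" using pq(4) by (simp add: H.perp_def)
    thus False using pq(6) by simp
  qed
  ultimately have s: "s\<^sup>2 < 1" using H.g_pos[of r] by simp
  define t where "t = sqrt (1 - s\<^sup>2)"
  have t: "t > 0" "t * t = 1 - s\<^sup>2" using s by (auto simp: t_def)
  define q' where "q' = (1 / t) *\<^sub>R r"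
  have q't: "t *\<^sub>R q' = r" using t(1) by (simp add: q'_def)
  have "h q' q' = 1" using \<open>h r r = 1 - s\<^sup>2\<close> t by (simp add: q'_def field_simps)
  moreover have "h p q' = 0" "h p (J q') = 0"
    by (simp_all add: q'_def r_def hv pq)
  ultimately have un: "unitary J h [p, q']" using pq(5) by simp
  have q'P: "q' \<in> H.perp U"
    using pq(3,4) H.J_perp[OF JU] unfolding q'_def r_def
    by (intro subspace_scale subspace_diff H.subspace_perp) auto
  obtain es where es: "H.subframe U es" using H.exists_subframe[OF U JU] by blast
  have F: "H.frame (es @ [p, q'])"
  proof (rule H.frame_append[OF es JU un])
    show "set [p, q'] \<subseteq> H.perp U" using pq(3) q'P by simp
    fix x assume x: "x \<in> H.perp U" and o: "\<And>v. v \<in> set (pairs J [p, q']) \<Longrightarrow> h x v = 0"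
    have q: "q = t *\<^sub>R q' + s *\<^sub>R J p" using q't by (simp add: r_def)
    have 0: "h x p = 0" "h x (J p) = 0" "h x q' = 0" "h x (J q') = 0" using o by auto
    have "h x q = 0" "h x (J q) = 0" by (subst q, simp add: 0)+
    moreover obtain a b c d where "x = a *\<^sub>R p + b *\<^sub>R q + c *\<^sub>R J p + d *\<^sub>R J q" using span[OF x] by blast
    hence "h x x = h x (a *\<^sub>R p + b *\<^sub>R q + c *\<^sub>R J p + d *\<^sub>R J q)" by simp
    ultimately have "h x x = 0" by (simp add: 0)
    thus "x = 0" by simp
  qed
  have "br p (J p) + br q' (J q') = 0"
    using frame_sum_ideal[OF _ _ F] H.subframeD(2)[OF es] by (auto simp: U_def subset_iff)
  \<comment> \<open>Multiplying by t^2 clears the normalization of q'; expanding \<open>r\<close>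
    then cancels the multiples of \<open>br p (J p)\<close> by \<open>s\<^sup>2\<close>.\<close>
  hence "(t * t) *\<^sub>R br p (J p) + br (t *\<^sub>R q') (J (t *\<^sub>R q')) = 0"
    by (simp add: scaleR_add_right[symmetric])
  hence fsum: "br p (J p) + br q (J q) = s *\<^sub>R br (J p) (J q)"
    unfolding q't t(2) using A(3)[OF pq(2,1)] G.br_skew[of "J p" p]
    by (simp add: r_def power2_eq_square algebra_simps)
  \<comment> \<open>\<open>p + s *\<^sub>R J q\<close> is \<open>h\<close>-orthogonal to
    \<open>q\<close>, \<open>J p\<close> and \<open>J q\<close>, and its product with
    \<open>p\<close> is \<open>1 - s\<^sup>2\<close>; \<open>be\<close> arises likewise from
    \<open>r\<close>.\<close>
  define al where "al v = h v (p + s *\<^sub>R J q) / (1 - s\<^sup>2)" for v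
  define be where "be v = h v (q - s *\<^sub>R J p) / (1 - s\<^sup>2)" for v
  have s0: "1 - s * s \<noteq> 0" using s by (simp add: power2_eq_square)
  have lin: "linear al" "linear be" by (simp_all add: linear_iff al_def be_def 
      add_divide_distrib diff_divide_distrib algebra_simps)
  have hU: "h u p = 0" "h u q = 0" "h u (J p) = 0" "h u (J q) = 0" if "u \<in> U" for u
  proof -
    have "p \<in> H.perp U" "q \<in> H.perp U" "J p \<in> H.perp U" "J q \<in> H.perp U"
      using pq H.J_perp[OF JU] by auto
    thus "h u p = 0" "h u q = 0" "h u (J p) = 0" "h u (J q) = 0"
      using that H.g_sym[of u] by (auto simp: H.perp_def)
  qed
  have al: "al p = 1" "al q = 0" "al (J p) = 0" "al (J q) = 0"
    and be: "be p = 0" "be q = 1" "be (J p) = 0" "be (J q) = 0"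
    using s0 by (simp_all add: al_def be_def hv pq power2_eq_square)
  have alU: "al u = 0" "be u = 0" if "u \<in> U" for u using hU[OF that] by (simp_all add: al_def be_def)
  have rep: "v - (al v *\<^sub>R p + be v *\<^sub>R q - al (J v) *\<^sub>R J p - be (J v) *\<^sub>R J q) \<in> U" for v
  proof -
    obtain u where u: "u \<in> U" "v - u \<in> H.perp U" using H.projection_perp[OF es U JU] .
    obtain a b c d where "v - u = a *\<^sub>R p + b *\<^sub>R q + c *\<^sub>R J p + d *\<^sub>R J q" using span[OF u(2)] by blast
    hence v: "v = u + (a *\<^sub>R p + b *\<^sub>R q + c *\<^sub>R J p + d *\<^sub>R J q)" by (simp add: algebra_simps)
    have Ju: "J u \<in> U" using u(1) JU by auto
    note ls = linear_add[OF lin(1)] linear_add[OF lin(2)] linear_scale[OF lin(1)] linear_scale[OF lin(2)]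
      linear_neg[OF lin(1)] linear_neg[OF lin(2)] linear_diff[OF lin(1)] linear_diff[OF lin(2)]
    have "al v = a" "be v = b" "al (J v) = - c" "be (J v) = - d"
      unfolding v by (simp_all add: ls al be alU[OF u(1)] alU[OF Ju])
    hence "v - (al v *\<^sub>R p + be v *\<^sub>R q - al (J v) *\<^sub>R J p - be (J v) *\<^sub>R J q) = u"
      using v by (simp add: algebra_simps)
    thus ?thesis using u(1) by simp
  qed
  have UA: "U \<subseteq> A" and UI: "\<And>x. x \<in> A \<Longrightarrow> J x \<in> A \<Longrightarrow> x \<in> U" by (auto simp: U_def)
  interpret noninvariant_ideal J g br A U p q al be s
    by unfold_locales 
      (fact linear_add[OF lin(1)] linear_add[OF lin(2)] linear_scale[OF lin(1)] linear_scale[OF lin(2)]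
        cs pl uni ideal abelian U JU UA UI pq alU al be rep s fsum)+
  show ?thesis by (rule exists_kaehler)
qed

end

theorem corollary3:
  fixes br :: "'a::euclidean_space \<Rightarrow> 'a \<Rightarrow> 'a" and J :: "'a \<Rightarrow> 'a"
  assumes "even (DIM('a))"
    and "lie_bracket br"
    and "unimodular br"
    and "\<exists>A. lie_ideal br A \<and> abelian_on br A \<and> dim A + 2 = DIM('a)"
    and "complex_structure br J"
    and "\<exists>g. compatible_metric J g \<and> balanced br J g"
    and "\<exists>g. compatible_metric J g \<and> pluriclosed br J g"
  shows "\<exists>g. compatible_metric J g \<and> kaehler br J g"
proof -
  obtain A where A: "lie_ideal br A" "abelian_on br A" "dim A + 2 = DIM('a)" using assms(4) by blast
  obtain h where h: "compatible_metric J h" "balanced br J h" using assms(6) by blast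
  obtain g where g: "compatible_metric J g" "pluriclosed br J g" using assms(7) by blast
  have J: "linear J" "\<And>x. J (J x) = - x" using assms(5) by (auto simp: complex_structure_def)
  interpret metric_pair J g h br A
    by unfold_locales (fact linear_add[OF J(1)] linear_scale[OF J(1)] assms A g h J)+
  show ?thesis using exists_kaehler_invariant exists_kaehler_noninvariant by blast
qed

end
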